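(* Assume $x^{(0)}\neq0$. (a) If $a=0$, then for every $\sigma>0$, $x^{(k)}\to0$ almost surely as $k\to\infty$. (b) If $a\in(0,1]$, then $\mu_a(\sigma)<0$ if and only if $\sigma=\bar\sigma_a(s,d)$ for some $s>0$. In that case, if $s\ge1$ then $x^{(k)}\to0$ almost surely; if $s<1$ then $\mathbb E\|x^{(k)}\|^p\to0$ for every $p\in(0,s)$ and some subsequence $x^{(n_k)}$ converges to $0$ almost surely. (c) If $a\in(0,1]$ and $\mu_a(\sigma)>0$, then $\mathbb E\|x^{(k)}\|^p\to\infty$ for every $p>0$, and some subsequence satisfies $\|x^{(n_k)}\|\to\infty$ almost surely.
   Context: Fix an integer width $d\ge1$ and a parameter $a\in[0,1]$. The parametric ReLU $\phi_a:\mathbb{R}\to\mathbb{R}$ is $\phi_a(z)=z$ for $z>0$ and $\phi_a(z)=az$ for $z\le 0$; it is applied componentwise to vectors ($\phi_0$ is ReLU, $\phi_1$ is the identity). Given $\sigma>0$ and a deterministic input $x^{(0)}\in\mathbb{R}^d$, the layer outputs of the fully connected network with zero biases are $x^{(k+1)}=\phi_a(W^{(k+1)}x^{(k)})$, $k\ge0$, where all entries of all matrices $W^{(1)},W^{(2)},\dots\in\mathbb{R}^{d\times d}$ are i.i.d. $\mathcal{N}(0,\sigma^2)$. $\|\cdot\|$ denotes the Euclidean norm. With $Z\sim\mathcal N(0,I_d)$: $\mu_a(\sigma)=\log\sigma+\frac12\mathbb E[\log\|\phi_a(Z)\|^2]$, and for $s>0$, $\bar\sigma_a(s,d)=\big(\mathbb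 E\|\phi_a(Z)\|^s\big)^{-1/s}$. *)

theory Defs
  imports "HOL-Probability.Probability"
begin

definition prelu :: "real \<Rightarrow> real \<Rightarrow> real" where
  "prelu a z = (if z > 0 then z else a * z)"

definition prelu_vec :: "real \<Rightarrow> real ^ 'd \<Rightarrow> real ^ 'd" where
  "prelu_vec a v = (\<chi> i. prelu a (v $ i))"

text \<open>Layer outputs: x 0 = x0, x (k+1) = phi_a (W (k+1) x k). W 0 is unused.\<close>
fun layer :: "real \<Rightarrow> (nat \<Rightarrow> 'w \<Rightarrow> real ^ 'd ^ 'd) \<Rightarrow> real ^ 'd \<Rightarrow> nat \<Rightarrow> 'w \<Rightarrow> real ^ 'd" where
  "layer a W x0 0 \<omega> = x0"
| "layer a W x0 (Suc k) \<omega> = prelu_vec a (W (Suc k) \<omega> *v layer a W x0 k \<omega>)"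

definition std_gauss_vec :: "(real ^ 'd::finite) measure" where
  "std_gauss_vec = density lborel
     (\<lambda>z::real ^ 'd. ennreal ((2 * pi) powr (- real CARD('d) / 2) * exp (- (norm z)\<^sup>2 / 2)))"

definition mu_a :: "real \<Rightarrow> real \<Rightarrow> 'd::finite itself \<Rightarrow> real" where
  "mu_a a \<sigma> _ = ln \<sigma> + 1/2 * (\<integral>z. ln ((norm (prelu_vec a z))\<^sup>2) \<partial>(std_gauss_vec :: (real ^ 'd) measure))"

definition sigma_bar :: "real \<Rightarrow> real \<Rightarrow> 'd::finite itself \<Rightarrow> real" where
  "sigma_bar a s _ = (\<integral>z. norm (prelu_vec a z) powr s \<partial>(std_gauss_vec :: (real ^ 'd) measure)) powr (- 1 / s)"

end

theory Submission
  imports Defs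
begin

text \<open>
  Write \<open>g p\<close> for the expectation of \<open>(\<sigma> * norm (prelu_vec a Z)) powr p\<close>. By rotation invariance of the
  Gaussian and positive homogeneity of the activation, the \<open>p\<close>-th moment of the norm of layer \<open>k\<close> is
  exactly \<open>norm x0 powr p * g p ^ k\<close>, for positive, zero and negative \<open>p\<close>. Whenever \<open>g p < 1\<close> these
  moments are summable in \<open>k\<close>, so the \<open>p\<close>-th powers of the norms tend to 0 almost surely. The exponent
  \<open>p = 0\<close> settles the ReLU case, a positive \<open>p\<close> the contracting case and a small negative \<open>p\<close> the
  expanding case; in each of them the full sequence converges, so the identity serves as subsequence.
  For \<open>a > 0\<close>, \<open>g\<close> is the moment generating function of \<open>ln (\<sigma> * norm (prelu_vec a Z))\<close>: it is convex, has
  value 1 and slope \<open>mu_a\<close> at 0 and is unbounded, and \<open>\<sigma> = sigma_bar a s\<close> says precisely \<open>g s = 1\<close>.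
\<close>

section \<open>Moment generating functions\<close>

lemma exp_le_quadratic: "exp u \<le> 1 + u + u\<^sup>2 * exp \<bar>u\<bar>" for u :: real
proof -
  \<comment> \<open>Taylor with the Lagrange remainder at an intermediate point \<open>t\<close>;
    the factor 1/2 of the remainder is given away below.\<close>
  obtain t where t: "\<bar>t\<bar> \<le> \<bar>u\<bar>" "exp u = (\<Sum>m<2. u ^ m / fact m) + exp t / fact 2 * u ^ 2"
    using Maclaurin_exp_le[of u 2] by auto
  have "exp t * u\<^sup>2 \<le> exp \<bar>u\<bar> * u\<^sup>2"
    using t(1) by (intro mult_right_mono) auto
  moreover have "0 \<le> exp \<bar>u\<bar> * u\<^sup>2" by simp
  moreover have "exp u = 1 + u + exp t * u\<^sup>2 / 2" using t(2) by (simp add: numeral_2_eq_2)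
  ultimately show ?thesis by (simp only: mult.commute[of "u\<^sup>2"])
qed

text \<open>Equality would make \<open>ln\<close> touch its tangent line at \<open>exp u\<close>,
  which happens only at \<open>exp u = 1\<close>. This strictness later separates the moment
  generating function from 1.\<close>

lemma exp_gt_one_plus: "1 + u < exp u" if "u \<noteq> 0" for u :: real
proof (rule ccontr)
  assume "\<not> ?thesis"
  hence "ln (exp u) = exp u - 1" using exp_ge_add_one_self[of u] by simp
  hence "exp u = 1" by (rule ln_eq_minus_one[OF exp_gt_zero])
  thus False using that by simp
qed

lemma square_le_exp: "t\<^sup>2 \<le> 2 * exp t" if "0 \<le> t" for t :: real
  using exp_lower_Taylor_quadratic[OF that] that by simp

section \<open>Integrability, slope and roots\<close>

context prob_space
begin

text \<open>Domination by the sum of the endpoint exponentials: the sign of \<open>L x\<close>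
  decides which endpoint is the larger one.\<close>

lemma integrable_exp_mgf_interval:
  fixes L :: "'a \<Rightarrow> real"
  assumes [measurable]: "L \<in> borel_measurable M"
    and "integrable M (\<lambda>x. exp (\<alpha> * L x))" "integrable M (\<lambda>x. exp (\<beta> * L x))"
    and "\<alpha> \<le> p" "p \<le> \<beta>"
  shows "integrable M (\<lambda>x. exp (p * L x))"
proof (rule Bochner_Integration.integrable_bound)
  show "integrable M (\<lambda>x. exp (\<alpha> * L x) + exp (\<beta> * L x))" using assms by simp
  have "exp (p * L x) \<le> exp (\<alpha> * L x) + exp (\<beta> * L x)" for x
  proof (cases "L x \<ge> 0")
    case True
    hence "exp (p * L x) \<le> exp (\<beta> * L x)" using assms by (simp add: mult_right_mono)
    thus ?thesis by (simp add: add_increasing)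
  next
    case False
    hence "exp (p * L x) \<le> exp (\<alpha> * L x)" using assms by (simp add: mult_right_mono_neg)
    thus ?thesis by (simp add: add_increasing2)
  qed
  thus "AE x in M. norm (exp (p * L x)) \<le> norm (exp (\<alpha> * L x) + exp (\<beta> * L x))"
    by (simp add: abs_of_nonneg add_nonneg_nonneg)
qed simp

text \<open>Provides the dominating function for the second-order remainder of
  \<open>exp (p * L x)\<close>, uniformly in |p| <= 1/4. The square costs one more
  quarter-exponential, and two quarters fit the assumed exponents of size 1/2.\<close>

lemma integrable_sq_exp:
  fixes L :: "'a \<Rightarrow> real"
  assumes [measurable]: "L \<in> borel_measurable M"
    and "integrable M (\<lambda>x. exp (-1/2 * L x))" "integrable M (\<lambda>x. exp (1/2 * L x))"
  shows "integrable M (\<lambda>x. (L x)\<^sup>2 * exp (\<bar>L x\<bar> / 4))"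
proof (rule Bochner_Integration.integrable_bound)
  show "integrable M (\<lambda>x. 32 * (exp (-1/2 * L x) + exp (1/2 * L x)))" using assms by simp
  have "(L x)\<^sup>2 * exp (\<bar>L x\<bar> / 4) \<le> 32 * (exp (-1/2 * L x) + exp (1/2 * L x))" for x
  proof -
    \<comment> \<open>The constant is 2 * 16, from \<open>square_le_exp\<close> at a quarter of |L
      x|.\<close>
    have "(L x)\<^sup>2 \<le> 32 * exp (\<bar>L x\<bar> / 4)"
      using square_le_exp[of "\<bar>L x\<bar> / 4"] by (simp add: power_divide)
    hence "(L x)\<^sup>2 * exp (\<bar>L x\<bar> / 4) \<le> 32 * exp (\<bar>L x\<bar> / 4) * exp (\<bar>L x\<bar> / 4)"
      by (intro mult_right_mono) auto
    also have "\<dots> = 32 * exp (\<bar>L x\<bar> / 2)" by (simp flip: exp_add)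
    also have "exp (\<bar>L x\<bar> / 2) \<le> exp (-1/2 * L x) + exp (1/2 * L x)"
      by (cases "L x \<ge> 0") (auto simp: add_increasing add_increasing2)
    finally show ?thesis by simp
  qed
  thus "AE x in M. norm ((L x)\<^sup>2 * exp (\<bar>L x\<bar> / 4)) \<le> norm (32 * (exp (-1/2 * L x) + exp (1/2 * L x)))"
    by (simp add: abs_of_nonneg add_nonneg_nonneg)
qed simp

lemma integrable_of_mgf:
  fixes L :: "'a \<Rightarrow> real"
  assumes [measurable]: "L \<in> borel_measurable M"
    and "integrable M (\<lambda>x. exp (-1/2 * L x))" "integrable M (\<lambda>x. exp (1/2 * L x))"
  shows "integrable M L"
proof (rule Bochner_Integration.integrable_bound)
  show "integrable M (\<lambda>x. 1 + (L x)\<^sup>2 * exp (\<bar>L x\<bar> / 4))"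
    using integrable_sq_exp[OF assms] by simp
  have "\<bar>L x\<bar> \<le> 1 + (L x)\<^sup>2 * exp (\<bar>L x\<bar> / 4)" for x
  proof -
    have "\<bar>L x\<bar> \<le> 1 + (L x)\<^sup>2"
      using sum_squares_bound[of "\<bar>L x\<bar>" 1] by simp
    moreover have "(L x)\<^sup>2 * 1 \<le> (L x)\<^sup>2 * exp (\<bar>L x\<bar> / 4)"
      by (intro mult_left_mono) auto
    ultimately show ?thesis by simp
  qed
  thus "AE x in M. norm (L x) \<le> norm (1 + (L x)\<^sup>2 * exp (\<bar>L x\<bar> / 4))"
    by (simp add: abs_of_nonneg add_nonneg_nonneg)
qed simp

text \<open>The tangent line of \<open>exp\<close> at 0, integrated. It yields values above 1 at
  positive exponents from a positive mean, and a negative mean from one value below 1 at a positive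
  exponent.\<close>

lemma mgf_ge_linear:
  fixes L :: "'a \<Rightarrow> real"
  assumes "integrable M L" "integrable M (\<lambda>x. exp (p * L x))"
  shows "1 + p * expectation L \<le> expectation (\<lambda>x. exp (p * L x))"
proof -
  have "1 + p * expectation L = expectation (\<lambda>x. 1 + p * L x)"
    using assms by (simp add: prob_space)
  also have "\<dots> \<le> expectation (\<lambda>x. exp (p * L x))"
    using assms by (intro integral_mono) auto
  finally show ?thesis .
qed

text \<open>The moment generating function has derivative \<open>expectation L\<close> at 0, so it dips below 1 on
  the side where this slope is negative.\<close>

lemma mgf_less_1:
  fixes L :: "'a \<Rightarrow> real" and e :: real
  assumes [measurable]: "L \<in> borel_measurable M"
    and i: "integrable M (\<lambda>x. exp (-1/2 * L x))" "integrable M (\<lambda>x. exp (1/2 * L x))"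
    and e: "\<bar>e\<bar> = 1" "e * expectation L < 0"
  obtains p where "0 < p" "p \<le> 1/4" "expectation (\<lambda>x. exp (e * p * L x)) < 1"
proof -
  define K where "K = expectation (\<lambda>x. (L x)\<^sup>2 * exp (\<bar>L x\<bar> / 4))"
  define m where "m = - (e * expectation L)"
  have m: "m > 0" using e by (simp add: m_def)
  have K: "K \<ge> 0" unfolding K_def by (intro integral_nonneg_AE) auto
  \<comment> \<open>The bound 1/4 keeps the remainder under the dominating function; the other one
    makes \<open>p * K < m\<close>, so that the linear term \<open>p * m\<close> beats
    \<open>p\<^sup>2 * K\<close>. Writing \<open>K + 1\<close> keeps the quotient meaningful for
    \<open>K = 0\<close>.\<close>
  define p where "p = min (1/4) (m / (2 * (K + 1)))"
  have p: "0 < p" "p \<le> 1/4" "p \<le> m / (2 * (K + 1))" using m K unfolding p_def by (simp_all only: min.cobounded1 min.cobounded2) auto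
  have "expectation (\<lambda>x. exp (e * p * L x)) \<le>
        expectation (\<lambda>x. 1 + e * p * L x + p\<^sup>2 * ((L x)\<^sup>2 * exp (\<bar>L x\<bar> / 4)))"
  proof (rule integral_mono)
    show "integrable M (\<lambda>x. exp (e * p * L x))"
      using e p by (intro integrable_exp_mgf_interval[OF assms(1) i]) (auto simp: abs_if split: if_splits)
    show "integrable M (\<lambda>x. 1 + e * p * L x + p\<^sup>2 * ((L x)\<^sup>2 * exp (\<bar>L x\<bar> / 4)))"
      using integrable_sq_exp[OF assms(1) i] integrable_of_mgf[OF assms(1) i] by simp
    fix x
    have "exp (e * p * L x) \<le> 1 + e * p * L x + (e * p * L x)\<^sup>2 * exp \<bar>e * p * L x\<bar>"
      by (rule exp_le_quadratic)
    \<comment> \<open>The sign \<open>e\<close> drops out of the remainder, so both directions share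
      one bound.\<close>
    also have "(e * p * L x)\<^sup>2 = p\<^sup>2 * (L x)\<^sup>2"
      using e(1) by (simp add: power_mult_distrib abs_square_eq_1)
    also have "\<bar>e * p * L x\<bar> = p * \<bar>L x\<bar>" using e(1) p by (simp add: abs_mult)
    also have "p\<^sup>2 * (L x)\<^sup>2 * exp (p * \<bar>L x\<bar>) \<le> p\<^sup>2 * (L x)\<^sup>2 * exp (\<bar>L x\<bar> / 4)"
      using p mult_right_mono[of p "1/4" "\<bar>L x\<bar>"] by (intro mult_left_mono) auto
    finally show "exp (e * p * L x) \<le> 1 + e * p * L x + p\<^sup>2 * ((L x)\<^sup>2 * exp (\<bar>L x\<bar> / 4))"
      by (simp add: mult_ac)
  qed
  also have "\<dots> = 1 - p * m + p\<^sup>2 * K"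
    using integrable_sq_exp[OF assms(1) i] integrable_of_mgf[OF assms(1) i]
    by (simp add: prob_space K_def m_def)
  also have "\<dots> < 1"
  proof -
    have "p * K < p * (K + 1) * 2" using p K by (simp add: algebra_simps) (smt (verit) mult_nonneg_nonneg)
    also have "\<dots> \<le> m" using p(3) K by (simp add: field_simps)
    finally have "p * (p * K) < p * m" using p(1) by simp
    thus ?thesis by (simp add: power2_eq_square mult_ac)
  qed
  finally show ?thesis using that[of p] p by blast
qed

text \<open>Strict convexity: the function equals 1 at the exponents 0 and \<open>s\<close>, hence
  lies strictly below 1 in between. Equality would force \<open>L = 0\<close> almost everywhere,
  which \<open>nondeg\<close> excludes.\<close>

lemma mgf_less_1_below_root:
  fixes L :: "'a \<Rightarrow> real"
  assumes [measurable]: "L \<in> borel_measurable M"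
    and i: "integrable M (\<lambda>x. exp (s * L x))"
    and eq: "expectation (\<lambda>x. exp (s * L x)) = 1"
    and p: "0 < p" "p < s"
    and nondeg: "\<not> (AE x in M. L x \<le> 0)"
  shows "expectation (\<lambda>x. exp (p * L x)) < 1"
proof -
  define \<theta> where "\<theta> = p / s"
  have \<theta>: "0 < \<theta>" "\<theta> < 1" "p = \<theta> * s" using p by (auto simp: \<theta>_def)
  have strict: "exp (p * L x) < \<theta> * exp (s * L x) + (1 - \<theta>)" if "L x \<noteq> 0" for x
  proof -
    let ?u = "s * L x"
    have u: "?u \<noteq> 0" using that p by auto
    have a: "exp (- \<theta> * ?u) > 1 + - \<theta> * ?u"
      using exp_gt_one_plus[of "- \<theta> * ?u"] \<theta> u by fastforce
    have b: "exp ((1 - \<theta>) * ?u) > 1 + (1 - \<theta>) * ?u"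
      using exp_gt_one_plus[of "(1-\<theta>) * ?u"] \<theta> u by fastforce
    \<comment> \<open>With \<open>exp (\<theta> * ?u)\<close> factored out, the endpoints 0 and
      \<open>?u\<close> become the increments \<open>- \<theta> * ?u\<close> and
      \<open>(1 - \<theta>) * ?u\<close>, whose linear terms cancel under the weights.\<close>
    have "1 = (1 - \<theta>) * (1 + - \<theta> * ?u) + \<theta> * (1 + (1 - \<theta>) * ?u)"
      by (simp add: algebra_simps)
    also have "\<dots> < (1 - \<theta>) * exp (- \<theta> * ?u) + \<theta> * exp ((1 - \<theta>) * ?u)"
      using a b \<theta> by (intro add_strict_mono mult_strict_left_mono) auto
    finally have "exp (\<theta> * ?u) * 1 < exp (\<theta> * ?u) * ((1 - \<theta>) * exp (- \<theta> * ?u) + \<theta> * exp ((1 - \<theta>) * ?u))"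
      by (intro mult_strict_left_mono) auto
    also have "\<dots> = (1 - \<theta>) * (exp (\<theta> * ?u) * exp (- \<theta> * ?u)) + \<theta> * (exp (\<theta> * ?u) * exp ((1 - \<theta>) * ?u))"
      by (simp add: algebra_simps)
    also have "\<dots> = \<theta> * exp ?u + (1 - \<theta>)"
      by (simp add: algebra_simps flip: exp_add)
    finally show ?thesis by (simp add: \<theta> mult.assoc)
  qed
  have le: "exp (p * L x) \<le> \<theta> * exp (s * L x) + (1 - \<theta>)" for x
    using strict[of x] by (cases "L x = 0") auto
  have ip: "integrable M (\<lambda>x. exp (p * L x))"
    by (rule integrable_exp_mgf_interval[OF assms(1) _ i, of 0]) (use p in auto)
  \<comment> \<open>The gap in the convexity inequality: being nonnegative, it would vanish almost
    everywhere if its mean were 0.\<close>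
  define D where "D x = \<theta> * exp (s * L x) + (1 - \<theta>) - exp (p * L x)" for x
  have iD: "integrable M D" unfolding D_def using i ip by simp
  have ED: "expectation D = 1 - expectation (\<lambda>x. exp (p * L x))"
    unfolding D_def using i ip eq by (simp add: prob_space)
  have "expectation D \<ge> 0" by (rule integral_nonneg_AE) (use le in \<open>auto simp: D_def\<close>)
  moreover have "expectation D \<noteq> 0"
  proof
    assume "expectation D = 0"
    hence "AE x in M. D x = 0"
      using integral_nonneg_eq_0_iff_AE[OF iD] le by (auto simp: D_def)
    hence "AE x in M. L x \<le> 0"
    proof eventually_elim
      case (elim x)
      thus ?case using strict[of x] by (cases "L x = 0") (auto simp: D_def)
    qed
    thus False using nondeg by simp
  qed
  ultimately show ?thesis using ED by linarith
qed

text \<open>Convexity of \<open>exp\<close> integrates. The purpose is continuity, which every real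
  convex function on an open interval has.\<close>

lemma mgf_convex:
  fixes L :: "'a \<Rightarrow> real"
  assumes i: "\<And>s. 0 < s \<Longrightarrow> integrable M (\<lambda>x. exp (s * L x))"
  shows "convex_on {0<..} (\<lambda>s. expectation (\<lambda>x. exp (s * L x)))"
proof (rule convex_onI)
  fix t u v :: real
  assume t: "0 < t" "t < 1" and uv: "u \<in> {0<..}" "v \<in> {0<..}"
  have "expectation (\<lambda>x. exp (((1 - t) *\<^sub>R u + t *\<^sub>R v) * L x)) \<le>
        expectation (\<lambda>x. (1 - t) * exp (u * L x) + t * exp (v * L x))"
  proof (rule integral_mono)
    show "integrable M (\<lambda>x. exp (((1 - t) *\<^sub>R u + t *\<^sub>R v) * L x))"
      using t uv by (intro i) (simp add: add_pos_pos)
    show "integrable M (\<lambda>x. (1 - t) * exp (u * L x) + t * exp (v * L x))" using i uv by simp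
    show "exp (((1 - t) *\<^sub>R u + t *\<^sub>R v) * L x) \<le> (1 - t) * exp (u * L x) + t * exp (v * L x)" for x
      using convex_onD[OF exp_convex, of t "u * L x" "v * L x"] t by (simp add: algebra_simps)
  qed
  also have "\<dots> = (1 - t) * expectation (\<lambda>x. exp (u * L x)) + t * expectation (\<lambda>x. exp (v * L x))"
    using i uv by simp
  finally show "expectation (\<lambda>x. exp (((1 - t) *\<^sub>R u + t *\<^sub>R v) * L x)) \<le>
     (1 - t) * expectation (\<lambda>x. exp (u * L x)) + t * expectation (\<lambda>x. exp (v * L x))" .
qed (rule convex_real_interval)

text \<open>The event \<open>1 < L x\<close> has positive probability \<open>q\<close>, and on it
  the integrand is at least \<open>exp s\<close>; so the mean is at least
  \<open>q * exp s\<close>.\<close>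

lemma mgf_unbounded:
  fixes L :: "'a \<Rightarrow> real"
  assumes [measurable]: "L \<in> borel_measurable M"
    and i: "\<And>s. 0 < s \<Longrightarrow> integrable M (\<lambda>x. exp (s * L x))"
    and nondeg: "\<not> (AE x in M. L x \<le> 1)"
  obtains s where "1 < s" "1 < expectation (\<lambda>x. exp (s * L x))"
proof -
  define q where "q = prob {x \<in> space M. 1 < L x}"
  have "q \<noteq> 0"
    using nondeg prob_eq_0[of "{x \<in> space M. 1 < L x}"] by (simp add: q_def not_less)
  hence q: "q > 0" by (simp add: q_def zero_less_measure_iff)
  \<comment> \<open>Chosen so that \<open>q * (1 + s) = 2 * q + 1\<close>, which exceeds 1, while
    \<open>1 + s\<close> is at most \<open>exp s\<close>.\<close>
  define s where "s = 1 + 1 / q"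
  have "1 < q * exp s"
  proof -
    have "1 < q * (1 + s)" using q by (simp add: s_def field_simps)
    also have "\<dots> \<le> q * exp s" using q by simp
    finally show ?thesis .
  qed
  also have "q * exp s = expectation (\<lambda>x. exp s * indicator {x \<in> space M. 1 < L x} x)"
    by (simp add: q_def)
  also have "\<dots> \<le> expectation (\<lambda>x. exp (s * L x))"
  proof (rule integral_mono)
    show "integrable M (\<lambda>x. exp s * indicator {x \<in> space M. 1 < L x} x)"
      by (intro integrable_mult_right integrable_real_indicator) (auto simp: emeasure_eq_measure)
    show "integrable M (\<lambda>x. exp (s * L x))" using q by (intro i) (simp add: s_def add_pos_pos)
    show "exp s * indicator {x \<in> space M. 1 < L x} x \<le> exp (s * L x)" for x
      using q by (auto simp: indicator_def s_def add_pos_pos)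
  qed
  finally show ?thesis using that[of s] q by (simp add: s_def)
qed

text \<open>Intermediate value theorem between the dip below 1 just right of 0, caused by the
  negative slope, and a value above 1 further out.\<close>

lemma mgf_root_exists:
  fixes L :: "'a \<Rightarrow> real"
  assumes L: "L \<in> borel_measurable M"
    and i0: "integrable M (\<lambda>x. exp (-1/2 * L x))"
    and i: "\<And>s. 0 < s \<Longrightarrow> integrable M (\<lambda>x. exp (s * L x))"
    and nondeg: "\<not> (AE x in M. L x \<le> 1)"
    and neg: "expectation L < 0"
  obtains s where "0 < s" "expectation (\<lambda>x. exp (s * L x)) = 1"
proof -
  let ?g = "\<lambda>s. expectation (\<lambda>x. exp (s * L x))"
  obtain p where p: "0 < p" "p \<le> 1/4" "?g p < 1"
    using mgf_less_1[OF L i0 i, of 1] neg by auto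
  obtain t where t: "1 < t" "1 < ?g t"
    using mgf_unbounded[OF L i nondeg] by blast
  have "continuous_on {0<..} ?g"
    by (intro convex_on_continuous mgf_convex i) auto
  hence "continuous_on {p..t} ?g" by (rule continuous_on_subset) (use p in auto)
  then obtain s where "p \<le> s" "s \<le> t" "?g s = 1"
    using IVT'[of ?g p 1 t] p t by auto
  thus ?thesis using that[of s] p by simp
qed

end

section \<open>The standard Gaussian vector\<close>

lemma norm_square_eq_sum_Basis: "(norm z)\<^sup>2 = (\<Sum>b\<in>Basis. (z \<bullet> b)\<^sup>2)" for z :: "'a::euclidean_space"
  unfolding power2_norm_eq_inner by (subst euclidean_inner) (simp add: power2_eq_square)

text \<open>Brings the density into the shape in which Lebesgue integrals factor over the
  coordinates.\<close>

lemma std_gauss_density_eq_prod: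
  fixes z :: "real ^ 'd::finite"
  shows "(2 * pi) powr (- real CARD('d) / 2) * exp (- (norm z)\<^sup>2 / 2)
         = (\<Prod>b\<in>Basis. std_normal_density (z \<bullet> b))"
proof -
  have "(\<Prod>b\<in>(Basis :: (real ^ 'd) set). 1 / sqrt (2 * pi)) = (2 * pi) powr (- real CARD('d) / 2)"
  proof -
    have "1 / sqrt (2 * pi) = (2 * pi) powr (- (1/2))"
      by (simp only: powr_minus_divide powr_half_sqrt pi_ge_zero mult_nonneg_nonneg zero_le_numeral)
    thus ?thesis by (simp add: powr_power)
  qed
  moreover have "exp (- (norm z)\<^sup>2 / 2) = (\<Prod>b\<in>Basis. exp (- (z \<bullet> b)\<^sup>2 / 2))"
    unfolding norm_square_eq_sum_Basis
    by (simp add: exp_sum[symmetric] sum_negf sum_divide_distrib[symmetric])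
  moreover have "(\<Prod>b\<in>Basis. std_normal_density (z \<bullet> b))
      = (\<Prod>b\<in>(Basis :: (real ^ 'd) set). 1 / sqrt (2 * pi)) * (\<Prod>b\<in>Basis. exp (- (z \<bullet> b)\<^sup>2 / 2))"
    unfolding prod.distrib[symmetric] normal_density_def by simp
  ultimately show ?thesis by simp
qed

lemma sets_std_gauss_vec [measurable_cong, simp]: "sets std_gauss_vec = sets borel"
  by (simp add: std_gauss_vec_def)

lemma space_std_gauss_vec [simp]: "space std_gauss_vec = UNIV"
  by (simp add: std_gauss_vec_def)

text \<open>Independence of the coordinates as a factorization of integrals. Total mass, box
  probabilities and the moment bounds all come from a choice of \<open>f\<close>.\<close>

lemma nn_integral_std_gauss_vec_prod:
  fixes f :: "real ^ 'd::finite \<Rightarrow> real \<Rightarrow> ennreal"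
  assumes [measurable]: "\<And>b. b \<in> Basis \<Longrightarrow> f b \<in> borel_measurable borel"
  shows "(\<integral>\<^sup>+z. (\<Prod>b\<in>Basis. f b (z \<bullet> b)) \<partial>std_gauss_vec)
         = (\<Prod>b\<in>Basis. \<integral>\<^sup>+t. f b t * ennreal (std_normal_density t) \<partial>lborel)"
proof -
  have "(\<integral>\<^sup>+z. (\<Prod>b\<in>Basis. f b (z \<bullet> b)) \<partial>std_gauss_vec)
      = (\<integral>\<^sup>+z. ennreal (\<Prod>b\<in>Basis. std_normal_density (z \<bullet> b)) * (\<Prod>b\<in>Basis. f b (z \<bullet> b)) \<partial>lborel)"
    unfolding std_gauss_vec_def std_gauss_density_eq_prod
    by (subst nn_integral_density) auto
  also have "\<dots> = (\<integral>\<^sup>+z. (\<Prod>b\<in>Basis. f b (z \<bullet> b) * ennreal (std_normal_density (z \<bullet> b))) \<partial>lborel)"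
    by (simp add: prod.distrib prod_ennreal mult.commute)
  also have "\<dots> = (\<Prod>b\<in>Basis. \<integral>\<^sup>+t. f b t * ennreal (std_normal_density t) \<partial>lborel)"
    by (rule nn_integral_lborel_prod) auto
  finally show ?thesis .
qed

lemma nn_integral_std_normal_density: "(\<integral>\<^sup>+t. ennreal (std_normal_density t) \<partial>lborel) = 1"
  using prob_space.emeasure_space_1[OF prob_space_normal_density[of 1 0]]
  by (simp add: emeasure_density)

lemma prob_space_std_gauss_vec: "prob_space (std_gauss_vec :: (real ^ 'd::finite) measure)"
  by (rule prob_spaceI)
     (use nn_integral_std_gauss_vec_prod[of "\<lambda>(_ :: real ^ 'd) _. 1 :: ennreal"] nn_integral_std_normal_density
       in \<open>simp\<close>)

lemma emeasure_std_gauss_vec_box: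
  fixes l u :: "real ^ 'd::finite"
  shows "emeasure std_gauss_vec (box l u)
         = (\<Prod>b\<in>Basis. emeasure (density lborel std_normal_density) {l \<bullet> b<..<u \<bullet> b})"
proof -
  have "indicator (box l u) = (\<lambda>z. \<Prod>b\<in>Basis. indicator {l \<bullet> b<..<u \<bullet> b} (z \<bullet> b) :: ennreal)"
    by (auto simp: fun_eq_iff box_def split: split_indicator)
  hence "emeasure std_gauss_vec (box l u)
      = (\<integral>\<^sup>+z. (\<Prod>b\<in>Basis. indicator {l \<bullet> b<..<u \<bullet> b} (z \<bullet> b)) \<partial>std_gauss_vec)"
    by (subst nn_integral_indicator[symmetric]) auto
  thus ?thesis
    using nn_integral_std_gauss_vec_prod[of "\<lambda>b. indicator {l \<bullet> b<..<u \<bullet> b}"]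
    by (simp add: emeasure_density mult.commute)
qed

text \<open>Open boxes are stable under intersection, generate the Borel sets and exhaust the space,
  so they determine a finite measure.\<close>

lemma std_gauss_vec_eqI:
  fixes N :: "(real ^ 'd::finite) measure"
  assumes "sets N = sets borel"
    and "\<And>l u. emeasure N (box l u) = emeasure std_gauss_vec (box l u)"
  shows "N = std_gauss_vec"
proof -
  interpret G: prob_space "std_gauss_vec :: (real ^ 'd) measure" by (rule prob_space_std_gauss_vec)
  \<comment> \<open>The symmetric form of the rule asks for finiteness of the Gaussian on the
    exhausting boxes instead of finiteness of \<open>N\<close>.\<close>
  show ?thesis
  proof (rule measure_eqI_generator_eq[symmetric])
    let ?E = "range (\<lambda>(l, u). box l u :: (real ^ 'd) set)"
    show "Int_stable ?E"
      by (auto simp: Int_stable_def box_Int_box)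
    show "?E \<subseteq> Pow UNIV" "sets std_gauss_vec = sigma_sets UNIV ?E" "sets N = sigma_sets UNIV ?E"
      using assms(1) by (simp_all add: borel_eq_box)
    let ?A = "\<lambda>n::nat. box (- (real n *\<^sub>R One)) (real n *\<^sub>R One) :: (real ^ 'd) set"
    show "range ?A \<subseteq> ?E" "(\<Union>i. ?A i) = UNIV"
      unfolding UN_box_eq_UNIV by auto
    show "emeasure std_gauss_vec X = emeasure N X" if "X \<in> ?E" for X
      using that assms(2) by auto
  qed simp
qed

section \<open>Null sets, open boxes and moments\<close>

lemma AE_std_gauss_vec_lborel:
  "(AE z in std_gauss_vec. P z) \<longleftrightarrow> (AE z in (lborel :: (real ^ 'd::finite) measure). P z)"
  unfolding std_gauss_vec_def by (subst AE_density) auto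

text \<open>The density is positive everywhere, so a nonempty open box is not a null set. Almost
  sure claims can therefore be refuted by exhibiting a box on which they fail.\<close>

lemma AE_std_gauss_vec_box:
  fixes l u :: "real ^ 'd::finite"
  assumes "AE z in std_gauss_vec. P z" and "\<And>i. l $ i < u $ i"
  obtains z where "z \<in> box l u" "P z"
proof -
  have lu: "l \<bullet> b < u \<bullet> b" if "b \<in> Basis" for b
    using that assms(2) by (auto simp: Basis_vec_def inner_axis)
  have "\<exists>z\<in>box l u. P z"
  proof (rule ccontr)
    assume *: "\<not> ?thesis"
    have "AE z in lborel. z \<notin> box l u"
      using assms(1) unfolding AE_std_gauss_vec_lborel by eventually_elim (use * in auto)
    hence "emeasure lborel (box l u) = 0"
      by (subst (asm) AE_iff_measurable[where N="box l u"]) auto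
    moreover have "emeasure lborel (box l u) = ennreal (\<Prod>b\<in>Basis. (u - l) \<bullet> b)"
      using lu by (intro emeasure_lborel_box) (auto intro: less_imp_le)
    moreover have "(\<Prod>b\<in>Basis. (u - l) \<bullet> b) > 0"
      using lu by (intro prod_pos) (auto simp: inner_diff_left)
    ultimately show False by (metis ennreal_eq_0_iff not_less)
  qed
  thus ?thesis using that by blast
qed

text \<open>One function that dominates every positive moment. The weight takes only half of the
  Gaussian exponent and leaves, in each coordinate, a multiple of the density of variance 2.\<close>

lemma integrable_exp_norm_std_gauss_vec:
  "integrable std_gauss_vec (\<lambda>z :: real ^ 'd::finite. exp ((norm z)\<^sup>2 / 4))"
proof (rule integrableI_nonneg)
  have eq: "ennreal (exp ((norm z)\<^sup>2 / 4)) = (\<Prod>b\<in>Basis. ennreal (exp ((z \<bullet> b)\<^sup>2 / 4)))" for z :: "real ^ 'd"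
    unfolding norm_square_eq_sum_Basis
    by (simp add: prod_ennreal exp_sum[symmetric] sum_divide_distrib[symmetric])
  have 1: "exp (t\<^sup>2 / 4) * std_normal_density t = sqrt 2 * normal_density 0 (sqrt 2) t" for t :: real
  proof -
    have "exp (t\<^sup>2 / 4) * exp (- t\<^sup>2 / 2) = exp (- t\<^sup>2 / 4)"
      by (simp flip: exp_add)
    thus ?thesis by (simp add: normal_density_def real_sqrt_mult field_simps)
  qed
  have "(\<integral>\<^sup>+t. ennreal (exp (t\<^sup>2 / 4)) * ennreal (std_normal_density t) \<partial>lborel)
      = ennreal (sqrt 2) * (\<integral>\<^sup>+t. ennreal (normal_density 0 (sqrt 2) t) \<partial>lborel)"
    by (simp add: 1 ennreal_mult[symmetric] nn_integral_cmult[symmetric])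
  also have "(\<integral>\<^sup>+t. ennreal (normal_density 0 (sqrt 2) t) \<partial>lborel) = 1"
    using prob_space.emeasure_space_1[OF prob_space_normal_density[of "sqrt 2" 0]]
    by (simp add: emeasure_density)
  finally have 2: "(\<integral>\<^sup>+t. ennreal (exp (t\<^sup>2 / 4)) * ennreal (std_normal_density t) \<partial>lborel) = ennreal (sqrt 2)"
    by simp
  show "(\<integral>\<^sup>+z. ennreal (exp ((norm (z :: real ^ 'd))\<^sup>2 / 4)) \<partial>std_gauss_vec) < \<infinity>"
    using nn_integral_std_gauss_vec_prod[of "\<lambda>(_ :: real ^ 'd) t. ennreal (exp (t\<^sup>2 / 4))"]
    by (simp add: eq 2 ennreal_power)
qed auto

text \<open>The exponent exceeds -1, so the singularity at 0 is integrable; the left half is the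
  mirror image of the right one.\<close>

lemma nn_integral_abs_powr_unit_interval:
  "(\<integral>\<^sup>+t. ennreal (indicator {-1..1} t * \<bar>t\<bar> powr (-1/2)) \<partial>lborel) < \<infinity>"
proof -
  let ?h = "\<lambda>t::real. indicator {0..1} t * t powr (-1/2)"
  have "((\<lambda>t::real. t powr (-1/2)) has_integral 2) {0..1}"
    using has_integral_powr_from_0[of "-1/2" 1] by simp
  hence "(?h has_integral 2) UNIV"
    by (subst (asm) has_integral_restrict_UNIV[symmetric])
       (simp add: indicator_def of_bool_def if_distrib[of "\<lambda>x. x * _"] cong: if_cong)
  hence 1: "(\<integral>\<^sup>+t. ennreal (?h t) \<partial>lborel) = 2"
    by (subst nn_integral_has_integral_lborel) auto
  have 2: "(\<integral>\<^sup>+t. ennreal (?h (- t)) \<partial>lborel) = 2"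
    using 1 nn_integral_real_affine[of "\<lambda>t. ennreal (?h t)" "-1" 0] by simp
  have "(\<integral>\<^sup>+t. ennreal (indicator {-1..1} t * \<bar>t\<bar> powr (-1/2)) \<partial>lborel)
      \<le> (\<integral>\<^sup>+t. ennreal (?h t) + ennreal (?h (- t)) \<partial>lborel)"
    by (intro nn_integral_mono) (auto simp: indicator_def abs_if)
  also have "\<dots> = 4" by (subst nn_integral_add) (use 1 2 in auto)
  finally show ?thesis by (rule order.strict_trans1) simp
qed

text \<open>One coordinate suffices: it is at most the norm, a negative power reverses this, and the
  exponent -1/2 is integrable already in dimension one. Hence all dimensions are covered at
  once.\<close>

lemma integrable_norm_powr_std_gauss_vec:
  "integrable std_gauss_vec (\<lambda>z :: real ^ 'd::finite. norm z powr (-1/2))"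
proof (rule integrableI_nonneg)
  obtain c :: "real ^ 'd" where c: "c \<in> Basis" using nonempty_Basis by blast
  define f where "f b t = (if b = c then ennreal (\<bar>t\<bar> powr (-1/2)) else 1)" for b :: "real ^ 'd" and t :: real
  have [measurable]: "f b \<in> borel_measurable borel" for b by (simp add: f_def[abs_def])
  \<comment> \<open>Where the chosen coordinate is 0, the convention \<open>0 powr x = 0\<close> may
    break the comparison with the norm, so this null set is discarded.\<close>
  have ae: "AE z in std_gauss_vec. z \<bullet> c \<noteq> 0"
    unfolding AE_std_gauss_vec_lborel using c by (rule AE_lborel_inner_neq)
  have "(\<integral>\<^sup>+z. ennreal (norm (z :: real ^ 'd) powr (-1/2)) \<partial>std_gauss_vec)
      \<le> (\<integral>\<^sup>+z. (\<Prod>b\<in>Basis. f b (z \<bullet> b)) \<partial>std_gauss_vec)"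
  proof (rule nn_integral_mono_AE)
    show "AE z in std_gauss_vec. ennreal (norm z powr (-1/2)) \<le> (\<Prod>b\<in>Basis. f b (z \<bullet> b))"
      using ae
    proof eventually_elim
      case (elim z)
      have "(\<Prod>b\<in>Basis. f b (z \<bullet> b)) = f c (z \<bullet> c)"
        using c by (subst prod.mono_neutral_cong_right[of Basis "{c}" _ "\<lambda>b. f b (z \<bullet> b)"]) (auto simp: f_def)
      moreover have "norm z powr (-1/2) \<le> \<bar>z \<bullet> c\<bar> powr (-1/2)"
        using elim Basis_le_norm[OF c, of z] by (intro powr_mono2') auto
      ultimately show ?case by (simp add: f_def ennreal_leI)
    qed
  qed
  also have "\<dots> = (\<Prod>b\<in>Basis. \<integral>\<^sup>+t. f b t * ennreal (std_normal_density t) \<partial>lborel)"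
    by (rule nn_integral_std_gauss_vec_prod) simp
  also have "\<dots> < \<infinity>"
  proof -
    have fin: "(\<integral>\<^sup>+t. ennreal (\<bar>t\<bar> powr (-1/2)) * ennreal (std_normal_density t) \<partial>lborel) < \<infinity>"
    proof -
      \<comment> \<open>Inside \<open>{-1..1}\<close> the density is at most 1, outside the power
        is; each summand covers one region.\<close>
      have le: "\<bar>t\<bar> powr (-1/2) * std_normal_density t
            \<le> indicator {-1..1} t * \<bar>t\<bar> powr (-1/2) + std_normal_density t" for t :: real
      proof (cases "t \<in> {-1..1}")
        case True
        have "std_normal_density t \<le> 1"
        proof -
          have "1 \<le> sqrt (2 * pi)" using pi_ge_two by simp
          hence "1 / sqrt (2 * pi) * exp (- t\<^sup>2 / 2) \<le> 1 * 1"
            by (intro mult_mono) auto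
          thus ?thesis by (simp add: normal_density_def)
        qed
        hence "\<bar>t\<bar> powr (-1/2) * std_normal_density t \<le> \<bar>t\<bar> powr (-1/2) * 1"
          by (intro mult_left_mono) auto
        thus ?thesis using True by (simp add: add_increasing2)
      next
        case False
        hence "\<bar>t\<bar> powr (-1/2) \<le> 1 powr (-1/2)" by (intro powr_mono2') auto
        hence "\<bar>t\<bar> powr (-1/2) * std_normal_density t \<le> 1 * std_normal_density t"
          by (intro mult_right_mono) auto
        thus ?thesis using False by simp
      qed
      have "(\<integral>\<^sup>+t. ennreal (\<bar>t\<bar> powr (-1/2)) * ennreal (std_normal_density t) \<partial>lborel)
          \<le> (\<integral>\<^sup>+t. ennreal (indicator {-1..1} t * \<bar>t\<bar> powr (-1/2)) + ennreal (std_normal_density t) \<partial>lborel)"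
        using le by (intro nn_integral_mono) (simp flip: ennreal_mult ennreal_plus add: ennreal_leI)
      also have "\<dots> = (\<integral>\<^sup>+t. ennreal (indicator {-1..1} t * \<bar>t\<bar> powr (-1/2)) \<partial>lborel) + 1"
        by (subst nn_integral_add) (auto simp: nn_integral_std_normal_density)
      also have "\<dots> < \<infinity>" using nn_integral_abs_powr_unit_interval by (simp add: ennreal_add_less_top)
      finally show ?thesis .
    qed
    have fin': "(\<integral>\<^sup>+t. f b t * ennreal (std_normal_density t) \<partial>lborel) < top" for b
      using fin by (cases "b = c") (simp_all add: f_def nn_integral_std_normal_density)
    show ?thesis
      unfolding infinity_ennreal_def top.not_eq_extremum[symmetric] ennreal_prod_eq_top
      using fin' by (metis less_irrefl)
  qed
  finally show "(\<integral>\<^sup>+z. ennreal (norm (z :: real ^ 'd) powr (-1/2)) \<partial>std_gauss_vec) < \<infinity>" .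
qed auto

section \<open>Moments of the layer outputs\<close>

lemma borel_measurable_vecI:
  fixes f :: "'a \<Rightarrow> real ^ 'n::finite"
  assumes "\<And>i. (\<lambda>x. f x $ i) \<in> borel_measurable M"
  shows "f \<in> borel_measurable M"
proof (subst borel_measurable_euclidean_space, rule ballI)
  fix b :: "real ^ 'n" assume "b \<in> Basis"
  then obtain i where "b = axis i 1" by (auto simp: Basis_vec_def)
  thus "(\<lambda>x. f x \<bullet> b) \<in> borel_measurable M" using assms[of i] by (simp add: inner_axis)
qed

lemma borel_measurable_vec_nth [measurable]:
  "(\<lambda>x :: real ^ 'n::finite. x $ i) \<in> borel_measurable borel"
  unfolding cart_eq_inner_axis by measurable

lemma prelu_vec_measurable [measurable]: "prelu_vec a \<in> borel_measurable borel"
proof (rule borel_measurable_vecI)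
  show "(\<lambda>x. prelu_vec a x $ i) \<in> borel_measurable borel" for i
    unfolding prelu_vec_def prelu_def vec_lambda_beta by measurable
qed

lemma prelu_vec_scaleR: "0 \<le> c \<Longrightarrow> prelu_vec a (c *\<^sub>R z) = c *\<^sub>R prelu_vec a z"
  by (auto simp: prelu_vec_def prelu_def vec_eq_iff zero_less_mult_iff)

lemma prelu_vec_0 [simp]: "prelu_vec a 0 = 0"
  by (simp add: prelu_vec_def prelu_def vec_eq_iff)

text \<open>General in \<open>V\<close> and \<open>N\<close> because layers are read both as
  functions on the probability space and as functions of a family of matrix entries.\<close>

lemma layer_measurable:
  assumes "\<And>k i j. 1 \<le> k \<Longrightarrow> k \<le> n \<Longrightarrow> (\<lambda>\<omega>. V k \<omega> $ i $ j) \<in> borel_measurable N"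
  shows "layer a V x0 n \<in> borel_measurable N"
  using assms
proof (induction n)
  case 0
  show ?case by (simp add: measurable_def space_borel)
next
  case (Suc n)
  have [measurable]: "layer a V x0 n \<in> borel_measurable N"
    using Suc by simp
  have [measurable]: "(\<lambda>\<omega>. V (Suc n) \<omega> $ i $ j) \<in> borel_measurable N" for i j
    using Suc.prems by simp
  have [measurable]: "(\<lambda>\<omega>. V (Suc n) \<omega> *v layer a V x0 n \<omega>) \<in> borel_measurable N"
    by (rule borel_measurable_vecI) (simp add: matrix_vector_mult_def)
  have "(\<lambda>\<omega>. prelu_vec a (V (Suc n) \<omega> *v layer a V x0 n \<omega>)) \<in> borel_measurable N"
    by measurable
  moreover have "layer a V x0 (Suc n) = (\<lambda>\<omega>. prelu_vec a (V (Suc n) \<omega> *v layer a V x0 n \<omega>))"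
    by (rule ext) simp
  ultimately show ?case by metis
qed

text \<open>The two sides may live over different sample spaces, which lets a layer be recomputed
  from its family of entries.\<close>

lemma layer_cong:
  assumes "\<And>k. 1 \<le> k \<Longrightarrow> k \<le> n \<Longrightarrow> V k \<omega> = V' k \<omega>'"
  shows "layer a V x0 n \<omega> = layer a V' x0 n \<omega>'"
  using assms by (induction n) auto

section \<open>The law of one layer and the moment recursion\<close>

locale gaussian_layers = prob_space M for M :: "'w measure" +
  fixes W :: "nat \<Rightarrow> 'w \<Rightarrow> real ^ 'd::finite ^ 'd" and \<sigma> :: real
  assumes sigma_pos: "\<sigma> > 0"
    and indep_entries: "indep_vars (\<lambda>_. borel) (\<lambda>(k, i, j) \<omega>. W k \<omega> $ i $ j) ({1..} \<times> UNIV \<times> UNIV)"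
    and entry_distributed: "\<And>k i j. k \<ge> 1 \<Longrightarrow>
      distributed M lborel (\<lambda>\<omega>. W k \<omega> $ i $ j) (\<lambda>t. ennreal (normal_density 0 \<sigma> t))"
begin

lemma entry_measurable: "k \<ge> 1 \<Longrightarrow> (\<lambda>\<omega>. W k \<omega> $ i $ j) \<in> borel_measurable M"
  using distributed_measurable[OF entry_distributed] by simp

text \<open>Each row of the product is a measurable function of one row of entries, and these blocks
  of entries are disjoint.\<close>

lemma row_indep:
  assumes "k \<ge> 1"
  shows "indep_vars (\<lambda>_. borel) (\<lambda>i \<omega>. (W k \<omega> *v y) $ i) UNIV"
proof -
  let ?K = "\<lambda>i::'d. {k} \<times> {i} \<times> (UNIV :: 'd set)"
  have "indep_vars (\<lambda>i. PiM (?K i) (\<lambda>_. borel))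
          (\<lambda>i \<omega>. restrict (\<lambda>l. (case l of (k, i, j) \<Rightarrow> \<lambda>\<omega>. W k \<omega> $ i $ j) \<omega>) (?K i)) UNIV"
    by (rule indep_vars_restrict[OF indep_entries]) (use assms in \<open>auto simp: disjoint_family_on_def\<close>)
  hence "indep_vars (\<lambda>_. borel) (\<lambda>i \<omega>. (\<lambda>f. \<Sum>j\<in>UNIV. f (k, i, j) * y $ j)
      (restrict (\<lambda>l. (case l of (k, i, j) \<Rightarrow> \<lambda>\<omega>. W k \<omega> $ i $ j) \<omega>) (?K i))) UNIV"
    by (rule indep_vars_compose2) auto
  thus ?thesis by (simp add: matrix_vector_mult_def)
qed

text \<open>A combination of independent centred Gaussians is Gaussian with deviation
  \<open>\<sigma> * norm y\<close>, which the normalization of \<open>y\<close> makes 1.\<close>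

lemma row_distributed:
  assumes k: "k \<ge> 1" and y: "norm y = 1 / \<sigma>"
  shows "distributed M lborel (\<lambda>\<omega>. (W k \<omega> *v y) $ i) std_normal_density"
proof -
  \<comment> \<open>Zero coefficients would give degenerate summands of deviation 0, whereas
    \<open>sum_indep_normal\<close> takes positive deviations and a nonempty index set.\<close>
  define J where "J = {j. y $ j \<noteq> 0}"
  have "y \<noteq> 0" using y sigma_pos by auto
  hence J: "J \<noteq> {}" by (auto simp: J_def vec_eq_iff)
  have sum_J: "(\<Sum>j\<in>J. g j) = (\<Sum>j\<in>UNIV. g j)" if "\<And>j. y $ j = 0 \<Longrightarrow> g j = 0" for g :: "'d \<Rightarrow> real"
    using that by (intro sum.mono_neutral_left) (auto simp: J_def)
  let ?K = "\<lambda>j::'d. {(k, i, j)}"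
  have "indep_vars (\<lambda>j. PiM (?K j) (\<lambda>_. borel))
          (\<lambda>j \<omega>. restrict (\<lambda>l. (case l of (k, i, j) \<Rightarrow> \<lambda>\<omega>. W k \<omega> $ i $ j) \<omega>) (?K j)) J"
    by (rule indep_vars_restrict[OF indep_entries]) (use k in \<open>auto simp: disjoint_family_on_def\<close>)
  hence "indep_vars (\<lambda>_. borel) (\<lambda>j \<omega>. (\<lambda>f. y $ j * f (k, i, j))
      (restrict (\<lambda>l. (case l of (k, i, j) \<Rightarrow> \<lambda>\<omega>. W k \<omega> $ i $ j) \<omega>) (?K j))) J"
    by (rule indep_vars_compose2) auto
  hence ind: "indep_vars (\<lambda>_. borel) (\<lambda>j \<omega>. y $ j * W k \<omega> $ i $ j) J" by simp
  have "distributed M lborel (\<lambda>\<omega>. \<Sum>j\<in>J. y $ j * W k \<omega> $ i $ j)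
          (normal_density (\<Sum>j\<in>J. 0) (sqrt (\<Sum>j\<in>J. (\<bar>y $ j\<bar> * \<sigma>)\<^sup>2)))"
  proof (rule sum_indep_normal[OF _ J ind])
    show "0 < \<bar>y $ j\<bar> * \<sigma>" if "j \<in> J" for j using that sigma_pos by (simp add: J_def)
    show "distributed M lborel (\<lambda>\<omega>. y $ j * W k \<omega> $ i $ j) (normal_density 0 (\<bar>y $ j\<bar> * \<sigma>))" if "j \<in> J" for j
      using normal_density_affine[OF entry_distributed[OF k] sigma_pos, where \<alpha> = "y $ j" and \<beta> = 0] that
      by (simp add: J_def)
  qed simp
  also have "(\<lambda>\<omega>. \<Sum>j\<in>J. y $ j * W k \<omega> $ i $ j) = (\<lambda>\<omega>. (W k \<omega> *v y) $ i)"
    by (subst sum_J) (auto simp: matrix_vector_mult_def mult.commute)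
  also have "(\<Sum>j\<in>J. (\<bar>y $ j\<bar> * \<sigma>)\<^sup>2) = (norm y * \<sigma>)\<^sup>2"
    by (subst sum_J) (auto simp: power_mult_distrib norm_vec_def L2_set_def sum_nonneg sum_distrib_right)
  also have "sqrt ((norm y * \<sigma>)\<^sup>2) = 1" using y sigma_pos by simp
  finally show ?thesis by simp
qed

lemma layer_input_measurable:
  assumes "k \<ge> 1"
  shows "(\<lambda>\<omega>. W k \<omega> *v y) \<in> borel_measurable M"
proof (rule borel_measurable_vecI)
  have [measurable]: "(\<lambda>\<omega>. W k \<omega> $ i $ j) \<in> borel_measurable M" for i j
    using assms by (rule entry_measurable)
  show "(\<lambda>\<omega>. (W k \<omega> *v y) $ i) \<in> borel_measurable M" for i
    by (simp add: matrix_vector_mult_def)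
qed

text \<open>Rotation invariance: the direction of \<open>y\<close> leaves no trace. Independent
  standard normal coordinates give every box its Gaussian mass, and boxes determine the law.\<close>

lemma distr_layer_input:
  assumes k: "k \<ge> 1" and y: "norm y = 1 / \<sigma>"
  shows "distr M borel (\<lambda>\<omega>. W k \<omega> *v y) = std_gauss_vec"
proof (rule std_gauss_vec_eqI)
  note [measurable] = layer_input_measurable[OF k]
  fix l u :: "real ^ 'd"
  have Basis: "(Basis :: (real ^ 'd) set) = (\<lambda>i. axis i 1) ` UNIV" by (auto simp: Basis_vec_def)
  have inj: "inj (\<lambda>i. axis i 1 :: real ^ 'd)" by (auto simp: inj_def axis_eq_axis)
  let ?X = "\<lambda>i \<omega>. (W k \<omega> *v y) $ i"
  have "emeasure (distr M borel (\<lambda>\<omega>. W k \<omega> *v y)) (box l u)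
      = emeasure M ((\<lambda>\<omega>. W k \<omega> *v y) -` box l u \<inter> space M)"
    by (rule emeasure_distr) auto
  also have "(\<lambda>\<omega>. W k \<omega> *v y) -` box l u \<inter> space M = (\<Inter>i. ?X i -` {l $ i<..<u $ i} \<inter> space M)"
    by (auto simp: mem_box_cart)
  also have "emeasure M \<dots> = ennreal (\<Prod>i\<in>UNIV. prob (?X i -` {l $ i<..<u $ i} \<inter> space M))"
    unfolding emeasure_eq_measure by (subst indep_varsD_finite[OF row_indep[OF k]]) auto
  also have "\<dots> = (\<Prod>i\<in>UNIV. emeasure M (?X i -` {l $ i<..<u $ i} \<inter> space M))"
    by (simp add: prod_ennreal emeasure_eq_measure)
  also have "\<dots> = (\<Prod>i\<in>UNIV. emeasure (density lborel std_normal_density) {l $ i<..<u $ i})"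
  proof (rule prod.cong)
    fix i
    note d = row_distributed[OF k y, of i]
    have "emeasure M (?X i -` {l $ i<..<u $ i} \<inter> space M) = emeasure (distr M lborel (?X i)) {l $ i<..<u $ i}"
      using distributed_measurable[OF d] by (subst emeasure_distr) auto
    thus "emeasure M (?X i -` {l $ i<..<u $ i} \<inter> space M)
        = emeasure (density lborel std_normal_density) {l $ i<..<u $ i}"
      using distributed_distr_eq_density[OF d] by simp
  qed simp
  also have "\<dots> = emeasure std_gauss_vec (box l u)"
    by (simp add: emeasure_std_gauss_vec_box Basis prod.reindex[OF inj] inner_axis)
  finally show "emeasure (distr M borel (\<lambda>\<omega>. W k \<omega> *v y)) (box l u) = emeasure std_gauss_vec (box l u)" .
qed simp

lemma nn_integral_layer_input:
  assumes k: "k \<ge> 1" and x: "x \<noteq> 0" and [measurable]: "g \<in> borel_measurable borel"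
  shows "(\<integral>\<^sup>+\<omega>. g (W k \<omega> *v x) \<partial>M) = (\<integral>\<^sup>+z. g ((\<sigma> * norm x) *\<^sub>R z) \<partial>std_gauss_vec)"
proof -
  \<comment> \<open>Dividing by \<open>\<tau>\<close> brings \<open>x\<close> to the norm
    \<open>1 / \<sigma>\<close> that produces a standard Gaussian; linearity returns the
    factor.\<close>
  define \<tau> where "\<tau> = \<sigma> * norm x"
  define y where "y = x /\<^sub>R \<tau>"
  have \<tau>: "\<tau> > 0" using x sigma_pos by (simp add: \<tau>_def)
  have y: "norm y = 1 / \<sigma>" using x sigma_pos by (simp add: y_def \<tau>_def field_simps)
  have x_eq: "x = \<tau> *\<^sub>R y" using \<tau> by (simp add: y_def)
  have "(\<integral>\<^sup>+\<omega>. g (W k \<omega> *v x) \<partial>M) = (\<integral>\<^sup>+\<omega>. g (\<tau> *\<^sub>R (W k \<omega> *v y)) \<partial>M)"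
    unfolding x_eq by (simp add: matrix_vector_mult_scaleR)
  also have "\<dots> = (\<integral>\<^sup>+z. g (\<tau> *\<^sub>R z) \<partial>distr M borel (\<lambda>\<omega>. W k \<omega> *v y))"
    by (subst nn_integral_distr) (auto intro: layer_input_measurable[OF k])
  finally show ?thesis by (simp add: distr_layer_input[OF k y] \<tau>_def)
qed

lemma layer_rv [measurable]: "layer a W x0 k \<in> borel_measurable M"
  by (rule layer_measurable) (rule entry_measurable)

text \<open>Fubini for a fresh layer: the new matrix is independent of the previous output, so it
  may be drawn from a separate sample \<open>\<omega>'\<close>.\<close>

lemma nn_integral_layer_Suc:
  assumes [measurable]: "g \<in> borel_measurable borel"
  shows "(\<integral>\<^sup>+\<omega>. g (layer a W x0 (Suc k) \<omega>) \<partial>M)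
       = (\<integral>\<^sup>+\<omega>. (\<integral>\<^sup>+\<omega>'. g (prelu_vec a (W (Suc k) \<omega>' *v layer a W x0 k \<omega>)) \<partial>M) \<partial>M)"
proof -
  \<comment> \<open>\<open>A\<close> and \<open>B\<close> index the entries of the first
    \<open>k\<close> matrices and of the next one; \<open>V\<close> reassembles matrices from such
    families. The integrand becomes a function \<open>h\<close> of the independent families
    \<open>X\<close> and \<open>Y\<close>.\<close>
  define A where "A = {1..k} \<times> (UNIV :: 'd set) \<times> (UNIV :: 'd set)"
  define B where "B = {Suc k} \<times> (UNIV :: 'd set) \<times> (UNIV :: 'd set)"
  let ?e = "\<lambda>\<omega> l. (case l of (k, i, j) \<Rightarrow> \<lambda>\<omega>. W k \<omega> $ i $ j) \<omega>"
  let ?P = "\<lambda>I. PiM I (\<lambda>_. borel :: real measure)"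
  define V :: "nat \<Rightarrow> (nat \<times> 'd \<times> 'd \<Rightarrow> real) \<Rightarrow> real ^ 'd ^ 'd" where "V = (\<lambda>k f. \<chi> i j. f (k, i, j))"
  define X where "X = (\<lambda>\<omega>. restrict (?e \<omega>) A)"
  define Y where "Y = (\<lambda>\<omega>. restrict (?e \<omega>) B)"
  define h where "h = (\<lambda>(f, f'). g (prelu_vec a (V (Suc k) f' *v layer a V x0 k f)))"
  have ind: "indep_var (?P A) X (?P B) Y"
    unfolding X_def Y_def by (rule indep_var_restrict[OF indep_entries]) (auto simp: A_def B_def)
  have [measurable]: "X \<in> M \<rightarrow>\<^sub>M ?P A" "Y \<in> M \<rightarrow>\<^sub>M ?P B"
    using indep_var_rv1[OF ind] indep_var_rv2[OF ind] by auto
  have [measurable]: "layer a V x0 k \<in> borel_measurable (?P A)"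
    by (rule layer_measurable) (simp add: V_def A_def B_def)
  have [measurable]: "(\<lambda>q. V (Suc k) (snd q) *v layer a V x0 k (fst q)) \<in> borel_measurable (?P A \<Otimes>\<^sub>M ?P B)"
  proof (rule borel_measurable_vecI)
    fix i
    have [measurable]: "(\<lambda>f. V (Suc k) f $ i $ j) \<in> borel_measurable (?P B)" for j
      by (simp add: V_def A_def B_def)
    show "(\<lambda>q. (V (Suc k) (snd q) *v layer a V x0 k (fst q)) $ i) \<in> borel_measurable (?P A \<Otimes>\<^sub>M ?P B)"
      unfolding matrix_vector_mult_def vec_lambda_beta by measurable
  qed
  have h [measurable]: "h \<in> borel_measurable (?P A \<Otimes>\<^sub>M ?P B)"
    unfolding h_def case_prod_beta by measurable
  have hXY: "h (X \<omega>, Y \<omega>') = g (prelu_vec a (W (Suc k) \<omega>' *v layer a W x0 k \<omega>))" for \<omega> \<omega>'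
  proof -
    have "V (Suc k) (Y \<omega>') = W (Suc k) \<omega>'" by (simp add: V_def Y_def B_def vec_eq_iff)
    moreover have "layer a V x0 k (X \<omega>) = layer a W x0 k \<omega>"
      by (rule layer_cong) (simp add: V_def X_def A_def vec_eq_iff)
    ultimately show ?thesis by (simp add: h_def)
  qed
  interpret DY: prob_space "distr M (?P B) Y" by (rule prob_space_distr) simp
  have "(\<integral>\<^sup>+\<omega>. g (layer a W x0 (Suc k) \<omega>) \<partial>M) = (\<integral>\<^sup>+\<omega>. h (X \<omega>, Y \<omega>) \<partial>M)"
    by (simp add: hXY)
  also have "\<dots> = (\<integral>\<^sup>+q. h q \<partial>distr M (?P A \<Otimes>\<^sub>M ?P B) (\<lambda>\<omega>. (X \<omega>, Y \<omega>)))"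
    by (subst nn_integral_distr) auto
  also have "\<dots> = (\<integral>\<^sup>+q. h q \<partial>(distr M (?P A) X \<Otimes>\<^sub>M distr M (?P B) Y))"
    using ind by (simp add: indep_var_distribution_eq)
  also have "\<dots> = (\<integral>\<^sup>+f. (\<integral>\<^sup>+f'. h (f, f') \<partial>distr M (?P B) Y) \<partial>distr M (?P A) X)"
    by (subst DY.nn_integral_fst[symmetric]) (simp_all cong: measurable_cong_sets)
  also have "\<dots> = (\<integral>\<^sup>+f. (\<integral>\<^sup>+\<omega>'. h (f, Y \<omega>') \<partial>M) \<partial>distr M (?P A) X)"
    by (intro nn_integral_cong nn_integral_distr) auto
  also have "\<dots> = (\<integral>\<^sup>+\<omega>. (\<integral>\<^sup>+\<omega>'. h (X \<omega>, Y \<omega>') \<partial>M) \<partial>M)"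
    by (subst nn_integral_distr) auto
  finally show ?thesis by (simp add: hXY)
qed

text \<open>Since \<open>0 powr p = 0\<close> for every \<open>p\<close>, this holds for all real exponents. The case \<open>p = 0\<close>
  computes the probability that the layer output is nonzero.\<close>

lemma layer_moment:
  "(\<integral>\<^sup>+\<omega>. ennreal (norm (layer a W x0 k \<omega>) powr p) \<partial>M)
   = ennreal (norm x0 powr p) *
     (\<integral>\<^sup>+z. ennreal ((\<sigma> * norm (prelu_vec a (z :: real ^ 'd))) powr p) \<partial>std_gauss_vec) ^ k"
  (is "_ = _ * ?c ^ k")
proof (induction k)
  case 0
  show ?case by (simp add: emeasure_space_1)
next
  case (Suc k)
  \<comment> \<open>With the previous output frozen at \<open>x\<close>, homogeneity extracts
    \<open>norm x powr p\<close>, and the factor \<open>?c\<close> that remains is the same for all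
    \<open>x\<close>.\<close>
  have inner: "(\<integral>\<^sup>+\<omega>. ennreal (norm (prelu_vec a (W (Suc k) \<omega> *v x)) powr p) \<partial>M) = ennreal (norm x powr p) * ?c"
    for x :: "real ^ 'd"
  proof (cases "x = 0")
    case True
    thus ?thesis by simp
  next
    case False
    have "(\<integral>\<^sup>+\<omega>. ennreal (norm (prelu_vec a (W (Suc k) \<omega> *v x)) powr p) \<partial>M)
        = (\<integral>\<^sup>+z. ennreal (norm (prelu_vec a ((\<sigma> * norm x) *\<^sub>R (z :: real ^ 'd))) powr p) \<partial>std_gauss_vec)"
      using nn_integral_layer_input[of "Suc k" x "\<lambda>v. ennreal (norm (prelu_vec a v) powr p)"] False
      by simp
    also have "\<dots> = (\<integral>\<^sup>+z. ennreal (norm x powr p) * ennreal ((\<sigma> * norm (prelu_vec a (z :: real ^ 'd))) powr p) \<partial>std_gauss_vec)"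
    proof (rule nn_integral_cong)
      fix z :: "real ^ 'd"
      have "norm (prelu_vec a ((\<sigma> * norm x) *\<^sub>R z)) = norm x * (\<sigma> * norm (prelu_vec a z))"
        using sigma_pos by (simp add: prelu_vec_scaleR)
      thus "ennreal (norm (prelu_vec a ((\<sigma> * norm x) *\<^sub>R z)) powr p)
          = ennreal (norm x powr p) * ennreal ((\<sigma> * norm (prelu_vec a z)) powr p)"
        using sigma_pos by (simp add: powr_mult ennreal_mult)
    qed
    also have "\<dots> = ennreal (norm x powr p) * ?c"
      by (rule nn_integral_cmult) simp
    finally show ?thesis .
  qed
  have "(\<integral>\<^sup>+\<omega>. ennreal (norm (layer a W x0 (Suc k) \<omega>) powr p) \<partial>M)
      = (\<integral>\<^sup>+\<omega>. ennreal (norm (layer a W x0 k \<omega>) powr p) * ?c \<partial>M)"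
    using nn_integral_layer_Suc[of "\<lambda>x. ennreal (norm x powr p)" a x0 k] unfolding inner by simp
  also have "\<dots> = (\<integral>\<^sup>+\<omega>. ennreal (norm (layer a W x0 k \<omega>) powr p) \<partial>M) * ?c"
    by (rule nn_integral_multc) simp
  finally show ?case unfolding Suc power_Suc by (simp only: mult_ac)
qed

text \<open>By Tonelli the expected sum over \<open>k\<close> is a convergent geometric series, so
  the sum is almost surely finite and its terms tend to 0.\<close>

lemma AE_layer_powr_tendsto_0:
  assumes "(\<integral>\<^sup>+z. ennreal ((\<sigma> * norm (prelu_vec a (z :: real ^ 'd))) powr p) \<partial>std_gauss_vec) < 1"
    (is "?c < 1")
  shows "AE \<omega> in M. (\<lambda>k. norm (layer a W x0 k \<omega>) powr p) \<longlonglongrightarrow> 0"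
proof -
  obtain c where c: "?c = ennreal c" "0 \<le> c" "c < 1"
    using assms by (cases ?c) auto
  have "(\<integral>\<^sup>+\<omega>. (\<Sum>k. ennreal (norm (layer a W x0 k \<omega>) powr p)) \<partial>M)
      = (\<Sum>k. \<integral>\<^sup>+\<omega>. ennreal (norm (layer a W x0 k \<omega>) powr p) \<partial>M)"
    by (rule nn_integral_suminf) simp
  also have "\<dots> = (\<Sum>k. ennreal (norm x0 powr p * c ^ k))"
    using c by (simp add: layer_moment ennreal_power ennreal_mult)
  also have "\<dots> < \<infinity>"
    using c by (simp add: suminf_ennreal2 summable_geometric summable_mult)
  finally have "AE \<omega> in M. (\<Sum>k. ennreal (norm (layer a W x0 k \<omega>) powr p)) \<noteq> \<infinity>"
    by (intro nn_integral_PInf_AE) auto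
  thus ?thesis
  proof eventually_elim
    case (elim \<omega>)
    hence "summable (\<lambda>k. norm (layer a W x0 k \<omega>) powr p)"
      by (intro summable_suminf_not_top) auto
    thus ?case by (rule summable_LIMSEQ_zero)
  qed
qed

end

section \<open>The gain of one layer\<close>

text \<open>The additive increment of the log-norm across a layer. For positive \<open>a\<close> and
  \<open>\<sigma>\<close> the argument of \<open>ln\<close> vanishes only at \<open>z = 0\<close>, a
  null set.\<close>

definition log_gain :: "real \<Rightarrow> real \<Rightarrow> real ^ 'd::finite \<Rightarrow> real" where
  "log_gain a \<sigma> z = ln (\<sigma> * norm (prelu_vec a z))"

lemma log_gain_measurable [measurable]: "log_gain a \<sigma> \<in> borel_measurable borel"
  unfolding log_gain_def[abs_def] by measurable

section \<open>Bounds and moments of the gain\<close>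

lemma norm_prelu_vec_le:
  assumes "0 \<le> a" "a \<le> 1"
  shows "norm (prelu_vec a z) \<le> norm z"
proof (rule norm_le_componentwise_cart)
  show "norm (prelu_vec a z $ i) \<le> norm (z $ i)" for i
    using assms mult_right_mono[of a 1 "z $ i"] mult_right_mono_neg[of a 1 "z $ i"]
    by (cases "0 < z $ i") (simp_all add: prelu_vec_def prelu_def abs_mult)
qed

text \<open>Carries the negative moment of \<open>norm z\<close> over to the gain. The bound
  degenerates at \<open>a = 0\<close>, where ReLU gets its own argument.\<close>

lemma norm_prelu_vec_ge:
  assumes "0 \<le> a" "a \<le> 1"
  shows "a * norm z \<le> norm (prelu_vec a z)"
proof -
  have "norm (a *\<^sub>R z) \<le> norm (prelu_vec a z)"
  proof (rule norm_le_componentwise_cart)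
    show "norm ((a *\<^sub>R z) $ i) \<le> norm (prelu_vec a z $ i)" for i
      using assms mult_right_mono[of a 1 "z $ i"] mult_right_mono_neg[of a 1 "z $ i"]
    by (cases "0 < z $ i") (simp_all add: prelu_vec_def prelu_def abs_mult)
  qed
  thus ?thesis using assms by simp
qed

lemma norm_prelu_vec_pos:
  assumes "0 < a" "a \<le> 1" "z \<noteq> 0"
  shows "0 < norm (prelu_vec a z)"
  using norm_prelu_vec_ge[of a z] assms by (smt (verit) mult_pos_pos zero_less_norm_iff)

lemma AE_std_gauss_vec_nonzero: "AE z in std_gauss_vec. z \<noteq> (0 :: real ^ 'd::finite)"
proof -
  obtain c :: "real ^ 'd" where "c \<in> Basis" using nonempty_Basis by blast
  hence "AE z in std_gauss_vec. z \<bullet> c \<noteq> 0"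
    unfolding AE_std_gauss_vec_lborel by (rule AE_lborel_inner_neq)
  thus ?thesis by eventually_elim auto
qed

lemma exp_log_gain:
  assumes "0 < a" "a \<le> 1" "0 < \<sigma>" "z \<noteq> 0"
  shows "exp (s * log_gain a \<sigma> z) = (\<sigma> * norm (prelu_vec a z)) powr s"
  using norm_prelu_vec_pos[OF assms(1,2,4)] assms by (simp add: log_gain_def powr_def)

text \<open>Since \<open>ln t\<close> is at most \<open>t\<close>, the exponent is at most
  \<open>s * t\<close>, and expanding the square of \<open>s - t / 2\<close> splits this
  product.\<close>

lemma powr_le_exp_square: "t powr s \<le> exp (s\<^sup>2) * exp (t\<^sup>2 / 4)" if "0 \<le> t" "0 < s" for s t :: real
proof (cases "t = 0")
  case False
  have "s * ln t \<le> s * t" using that False ln_bound[of t] by simp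
  also have "\<dots> \<le> s\<^sup>2 + t\<^sup>2 / 4"
    using zero_le_power2[of "s - t / 2"] by (simp add: power2_diff power_divide)
  finally show ?thesis using False by (simp add: powr_def flip: exp_add)
qed simp

lemma integrable_exp_log_gain_pos:
  assumes "0 < a" "a \<le> 1" "0 < \<sigma>" "0 < s"
  shows "integrable std_gauss_vec (\<lambda>z :: real ^ 'd::finite. exp (s * log_gain a \<sigma> z))"
proof (rule Bochner_Integration.integrable_bound)
  show "integrable std_gauss_vec (\<lambda>z :: real ^ 'd. \<sigma> powr s * (exp (s\<^sup>2) * exp ((norm z)\<^sup>2 / 4)))"
    using integrable_exp_norm_std_gauss_vec by (intro integrable_mult_right)
  show "AE z :: real ^ 'd in std_gauss_vec.
      norm (exp (s * log_gain a \<sigma> z)) \<le> norm (\<sigma> powr s * (exp (s\<^sup>2) * exp ((norm z)\<^sup>2 / 4)))"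
    using AE_std_gauss_vec_nonzero
  proof eventually_elim
    case (elim z)
    have "exp (s * log_gain a \<sigma> z) = \<sigma> powr s * norm (prelu_vec a z) powr s"
      using exp_log_gain[OF assms(1-3) elim] assms by (simp add: powr_mult)
    also have "norm (prelu_vec a z) powr s \<le> norm z powr s"
      using assms norm_prelu_vec_le[of a z] by (intro powr_mono2) auto
    also have "norm z powr s \<le> exp (s\<^sup>2) * exp ((norm z)\<^sup>2 / 4)"
      using assms by (intro powr_le_exp_square) auto
    finally show ?case by (simp add: mult_left_mono)
  qed
qed measurable

lemma integrable_exp_log_gain_neg:
  assumes "0 < a" "a \<le> 1" "0 < \<sigma>"
  shows "integrable std_gauss_vec (\<lambda>z :: real ^ 'd::finite. exp (-1/2 * log_gain a \<sigma> z))"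
proof (rule Bochner_Integration.integrable_bound)
  show "integrable std_gauss_vec (\<lambda>z :: real ^ 'd. (\<sigma> * a) powr (-1/2) * norm z powr (-1/2))"
    using integrable_norm_powr_std_gauss_vec by (intro integrable_mult_right)
  show "AE z :: real ^ 'd in std_gauss_vec.
      norm (exp (-1/2 * log_gain a \<sigma> z)) \<le> norm ((\<sigma> * a) powr (-1/2) * norm z powr (-1/2))"
    using AE_std_gauss_vec_nonzero
  proof eventually_elim
    case (elim z)
    have "exp (-1/2 * log_gain a \<sigma> z) = (\<sigma> * norm (prelu_vec a z)) powr (-1/2)"
      by (rule exp_log_gain[OF assms elim])
    also have "\<dots> \<le> (\<sigma> * (a * norm z)) powr (-1/2)"
      using assms elim norm_prelu_vec_ge[of a z] by (intro powr_mono2' mult_left_mono) auto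
    also have "\<dots> = (\<sigma> * a) powr (-1/2) * norm z powr (-1/2)"
      using assms by (simp add: powr_mult mult.assoc)
    finally show ?case by simp
  qed
qed measurable

text \<open>Interpolates between -1/2 and \<open>\<bar>s\<bar> + 1\<close>, which is positive and
  above \<open>s\<close> whatever the sign of \<open>s\<close>.\<close>

lemma integrable_exp_log_gain:
  assumes "0 < a" "a \<le> 1" "0 < \<sigma>" "-1/2 \<le> s"
  shows "integrable std_gauss_vec (\<lambda>z :: real ^ 'd::finite. exp (s * log_gain a \<sigma> z))"
  by (rule prob_space.integrable_exp_mgf_interval[OF prob_space_std_gauss_vec _
        integrable_exp_log_gain_neg[OF assms(1-3)] integrable_exp_log_gain_pos[OF assms(1-3), of "\<bar>s\<bar> + 1"]])
     (use assms in auto)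

lemma integrable_log_gain:
  assumes "0 < a" "a \<le> 1" "0 < \<sigma>"
  shows "integrable std_gauss_vec (log_gain a \<sigma> :: real ^ 'd::finite \<Rightarrow> real)"
  by (rule prob_space.integrable_of_mgf[OF prob_space_std_gauss_vec])
     (use integrable_exp_log_gain[OF assms, of "-1/2"] integrable_exp_log_gain[OF assms, of "1/2"] in auto)

text \<open>On the positive orthant the activation is the identity, so boxes far out in it have
  positive mass and arbitrarily large gain.\<close>

lemma log_gain_unbounded:
  assumes "0 < \<sigma>"
  shows "\<not> (AE z :: real ^ 'd::finite in std_gauss_vec. log_gain a \<sigma> z \<le> R)"
proof
  assume ae: "AE z :: real ^ 'd in std_gauss_vec. log_gain a \<sigma> z \<le> R"
  \<comment> \<open>The radius at which \<open>\<sigma> * r = exp R\<close>.\<close>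
  define r where "r = exp R / \<sigma>"
  have r: "r > 0" using assms by (simp add: r_def)
  obtain z :: "real ^ 'd" where z: "z \<in> box (\<chi> i. r) (\<chi> i. r + 1)" "log_gain a \<sigma> z \<le> R"
    using AE_std_gauss_vec_box[OF ae, of "\<chi> i. r" "\<chi> i. r + 1"] by auto
  have zi: "r < z $ i" for i using z(1) by (simp add: mem_box_cart)
  have "prelu_vec a z = z" using zi r by (simp add: prelu_vec_def prelu_def vec_eq_iff less_trans)
  moreover have "r < norm z" using zi[of undefined] component_le_norm_cart[of z undefined] by linarith
  ultimately have "exp R < \<sigma> * norm (prelu_vec a z)" using assms by (simp add: r_def field_simps)
  hence "R < log_gain a \<sigma> z" 
    unfolding log_gain_def using exp_gt_zero[of R] by (metis exp_less_cancel_iff exp_ln less_trans)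
  thus False using z(2) by simp
qed

section \<open>The quantities of the theorem in terms of the gain\<close>

lemma gain_moment_eq:
  assumes "0 < a" "a \<le> 1" "0 < \<sigma>" "-1/2 \<le> s"
  shows "(\<integral>\<^sup>+z. ennreal ((\<sigma> * norm (prelu_vec a (z :: real ^ 'd::finite))) powr s) \<partial>std_gauss_vec)
       = ennreal (\<integral>z. exp (s * log_gain a \<sigma> (z :: real ^ 'd)) \<partial>std_gauss_vec)"
proof -
  have "(\<integral>\<^sup>+z. ennreal ((\<sigma> * norm (prelu_vec a (z :: real ^ 'd))) powr s) \<partial>std_gauss_vec)
      = (\<integral>\<^sup>+z. ennreal (exp (s * log_gain a \<sigma> (z :: real ^ 'd))) \<partial>std_gauss_vec)"
  proof (rule nn_integral_cong_AE)
    show "AE z :: real ^ 'd in std_gauss_vec.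
        ennreal ((\<sigma> * norm (prelu_vec a z)) powr s) = ennreal (exp (s * log_gain a \<sigma> z))"
      using AE_std_gauss_vec_nonzero by eventually_elim (simp add: exp_log_gain[OF assms(1-3)])
  qed
  also have "\<dots> = ennreal (\<integral>z. exp (s * log_gain a \<sigma> (z :: real ^ 'd)) \<partial>std_gauss_vec)"
    by (rule nn_integral_eq_integral[OF integrable_exp_log_gain[OF assms]]) simp
  finally show ?thesis .
qed

lemma mu_a_eq_expectation:
  assumes "0 < a" "a \<le> 1" "0 < \<sigma>"
  shows "mu_a a \<sigma> TYPE('d::finite) = (\<integral>z. log_gain a \<sigma> (z :: real ^ 'd) \<partial>std_gauss_vec)"
proof -
  interpret G: prob_space "std_gauss_vec :: (real ^ 'd) measure" by (rule prob_space_std_gauss_vec)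
  note [simp] = integrable_log_gain[OF assms, where 'd='d]
  have "(\<integral>z. ln ((norm (prelu_vec a (z :: real ^ 'd)))\<^sup>2) \<partial>std_gauss_vec)
      = (\<integral>z. 2 * (log_gain a \<sigma> (z :: real ^ 'd) - ln \<sigma>) \<partial>std_gauss_vec)"
  proof (rule integral_cong_AE)
    show "AE z :: real ^ 'd in std_gauss_vec.
        ln ((norm (prelu_vec a z))\<^sup>2) = 2 * (log_gain a \<sigma> z - ln \<sigma>)"
      using AE_std_gauss_vec_nonzero
    proof eventually_elim
      case (elim z)
      thus ?case using norm_prelu_vec_pos[OF assms(1,2) elim] assms
        by (simp add: log_gain_def ln_mult ln_realpow)
    qed
  qed measurable
  also have "\<dots> = 2 * ((\<integral>z. log_gain a \<sigma> (z :: real ^ 'd) \<partial>std_gauss_vec) - ln \<sigma>)"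
    using G.prob_space by simp
  finally show ?thesis by (simp add: mu_a_def field_simps)
qed

text \<open>The factor \<open>\<sigma> powr s\<close> comes out of the moment, so
  \<open>sigma_bar\<close> is the scale that normalizes the \<open>s\<close>-th moment of the gain
  to 1.\<close>

lemma eq_sigma_bar_iff:
  assumes "0 < a" "a \<le> 1" "0 < \<sigma>" "0 < s"
  shows "\<sigma> = sigma_bar a s TYPE('d::finite)
         \<longleftrightarrow> (\<integral>z. exp (s * log_gain a \<sigma> (z :: real ^ 'd)) \<partial>std_gauss_vec) = 1"
proof -
  define m where "m = (\<integral>z. norm (prelu_vec a (z :: real ^ 'd)) powr s \<partial>std_gauss_vec)"
  have "(\<integral>z. exp (s * log_gain a \<sigma> (z :: real ^ 'd)) \<partial>std_gauss_vec)
      = (\<integral>z. \<sigma> powr s * norm (prelu_vec a (z :: real ^ 'd)) powr s \<partial>std_gauss_vec)"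
  proof (rule integral_cong_AE)
    show "AE z :: real ^ 'd in std_gauss_vec.
        exp (s * log_gain a \<sigma> z) = \<sigma> powr s * norm (prelu_vec a z) powr s"
      using AE_std_gauss_vec_nonzero
      by eventually_elim (use assms in \<open>simp add: exp_log_gain powr_mult\<close>)
  qed measurable
  hence eq: "(\<integral>z. exp (s * log_gain a \<sigma> (z :: real ^ 'd)) \<partial>std_gauss_vec) = \<sigma> powr s * m"
    by (simp add: m_def)
  have m: "m \<ge> 0" unfolding m_def by (rule integral_nonneg_AE) simp
  have "\<sigma> = m powr (-1/s) \<longleftrightarrow> \<sigma> powr s * m = 1"
  proof
    assume *: "\<sigma> = m powr (-1/s)"
    \<comment> \<open>A zero moment would give \<open>\<sigma> = 0\<close>, by the convention
      \<open>0 powr x = 0\<close>.\<close>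
    hence "m > 0" using m assms by (cases "m = 0") auto
    moreover have "\<sigma> powr s = m powr (-1)" using * assms by (simp add: powr_powr)
    ultimately show "\<sigma> powr s * m = 1" by (simp add: powr_minus)
  next
    assume "\<sigma> powr s * m = 1"
    hence "m = \<sigma> powr (- s)" using assms by (simp add: powr_minus field_simps)
    thus "\<sigma> = m powr (-1/s)" using assms by (simp add: powr_powr)
  qed
  thus ?thesis unfolding eq sigma_bar_def m_def[symmetric] .
qed

text \<open>As \<open>t powr 0\<close> is 1 for nonzero \<open>t\<close> and 0 for
  \<open>t = 0\<close>, the integral is the probability of a nonzero ReLU output. The negative
  orthant, of positive mass, is sent to 0.\<close>

lemma relu_gain_less_1:
  assumes "0 < \<sigma>"
  shows "(\<integral>\<^sup>+z. ennreal ((\<sigma> * norm (prelu_vec 0 (z :: real ^ 'd::finite))) powr 0) \<partial>std_gauss_vec) < 1"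
proof -
  interpret G: prob_space "std_gauss_vec :: (real ^ 'd) measure" by (rule prob_space_std_gauss_vec)
  let ?S = "{z :: real ^ 'd. prelu_vec 0 z \<noteq> 0}"
  have S: "?S \<in> sets std_gauss_vec" by simp
  have "(\<integral>\<^sup>+z. ennreal ((\<sigma> * norm (prelu_vec 0 (z :: real ^ 'd))) powr 0) \<partial>std_gauss_vec)
      = (\<integral>\<^sup>+z. indicator ?S z \<partial>std_gauss_vec)"
    using assms by (intro nn_integral_cong) (auto simp: indicator_def)
  also have "\<dots> = emeasure std_gauss_vec ?S" using S by (rule nn_integral_indicator)
  also have "\<dots> < 1"
  proof -
    have "G.prob ?S \<noteq> 1"
    proof
      assume "G.prob ?S = 1"
      hence ae: "AE z :: real ^ 'd in std_gauss_vec. prelu_vec 0 z \<noteq> 0"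
        using G.prob_eq_1[OF S] by simp
      obtain z :: "real ^ 'd" where z: "z \<in> box (\<chi> i. -1) (\<chi> i. 0)" "prelu_vec 0 z \<noteq> 0"
        using AE_std_gauss_vec_box[OF ae, of "\<chi> i. -1" "\<chi> i. 0"] by auto
      hence "z $ i < 0" for i by (simp add: mem_box_cart)
      hence "prelu_vec 0 z = 0" by (simp add: prelu_vec_def prelu_def vec_eq_iff not_less less_imp_le)
      thus False using z by simp
    qed
    hence "G.prob ?S < 1" using G.prob_le_1[of ?S] by linarith
    thus ?thesis by (simp add: G.emeasure_eq_measure)
  qed
  finally show ?thesis .
qed

section \<open>Convergence and divergence of the layer outputs\<close>

context gaussian_layers
begin

lemma layer_moment_log_gain:
  assumes "0 < a" "a \<le> 1" "-1/2 \<le> p"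
  shows "(\<integral>\<^sup>+\<omega>. ennreal (norm (layer a W x0 k \<omega>) powr p) \<partial>M)
    = ennreal (norm x0 powr p * (\<integral>z. exp (p * log_gain a \<sigma> (z :: real ^ 'd)) \<partial>std_gauss_vec) ^ k)"
  unfolding layer_moment gain_moment_eq[OF assms(1,2) sigma_pos assms(3)]
  by (simp add: ennreal_power ennreal_mult)

lemma AE_layer_powr_tendsto_0_log_gain:
  assumes "0 < a" "a \<le> 1" "-1/2 \<le> p"
    and "(\<integral>z. exp (p * log_gain a \<sigma> (z :: real ^ 'd)) \<partial>std_gauss_vec) < 1"
  shows "AE \<omega> in M. (\<lambda>k. norm (layer a W x0 k \<omega>) powr p) \<longlonglongrightarrow> 0"
  by (rule AE_layer_powr_tendsto_0)
     (use assms in \<open>simp add: gain_moment_eq[OF assms(1,2) sigma_pos assms(3)] ennreal_less_one_iff\<close>)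

lemma AE_layer_tendsto_0:
  assumes "0 < a" "a \<le> 1" "0 < p"
    and "(\<integral>z. exp (p * log_gain a \<sigma> (z :: real ^ 'd)) \<partial>std_gauss_vec) < 1"
  shows "AE \<omega> in M. (\<lambda>k. layer a W x0 k \<omega>) \<longlonglongrightarrow> 0"
proof -
  have "AE \<omega> in M. (\<lambda>k. norm (layer a W x0 k \<omega>) powr p) \<longlonglongrightarrow> 0"
    using assms by (intro AE_layer_powr_tendsto_0_log_gain) auto
  thus ?thesis
  proof eventually_elim
    case (elim \<omega>)
    have "(\<lambda>k. (norm (layer a W x0 k \<omega>) powr p) powr (1/p)) \<longlonglongrightarrow> 0 powr (1/p)"
      using assms elim by (intro tendsto_powr') (auto intro!: always_eventually)
    thus ?case using assms by (simp add: powr_powr tendsto_norm_zero_iff)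
  qed
qed

lemma AE_relu_layer_tendsto_0: "AE \<omega> in M. (\<lambda>k. layer 0 W x0 k \<omega>) \<longlonglongrightarrow> 0"
proof -
  have "AE \<omega> in M. (\<lambda>k. norm (layer 0 W x0 k \<omega>) powr 0) \<longlonglongrightarrow> 0"
    by (rule AE_layer_powr_tendsto_0) (rule relu_gain_less_1[OF sigma_pos])
  thus ?thesis
  proof eventually_elim
    case (elim \<omega>)
    \<comment> \<open>The sequence takes only the values 0 and 1, so its convergence to 0 means that
      the outputs are eventually exactly 0.\<close>
    have "eventually (\<lambda>k. norm (layer 0 W x0 k \<omega>) powr 0 < 1) sequentially"
      using order_tendstoD(2)[OF elim, of 1] by simp
    hence "eventually (\<lambda>k. layer 0 W x0 k \<omega> = 0) sequentially"
      by eventually_elim (auto split: if_splits)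
    thus ?case by (rule tendsto_eventually)
  qed
qed

text \<open>The exponent 0 again counts nonzero outputs, now with moment 1. Otherwise
  \<open>0 powr (- p) = 0\<close> would let vanishing outputs pass for exploding ones.\<close>

lemma AE_layer_nonzero:
  assumes "0 < a" "a \<le> 1" "x0 \<noteq> 0"
  shows "AE \<omega> in M. \<forall>k. layer a W x0 k \<omega> \<noteq> 0"
  unfolding AE_all_countable
proof
  fix k
  let ?S = "{\<omega> \<in> space M. layer a W x0 k \<omega> \<noteq> 0}"
  interpret G: prob_space "std_gauss_vec :: (real ^ 'd) measure" by (rule prob_space_std_gauss_vec)
  have S: "?S \<in> sets M" by measurable
  have "emeasure M ?S = (\<integral>\<^sup>+\<omega>. indicator ?S \<omega> \<partial>M)" using S by (rule nn_integral_indicator[symmetric])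
  also have "\<dots> = (\<integral>\<^sup>+\<omega>. ennreal (norm (layer a W x0 k \<omega>) powr 0) \<partial>M)"
    by (intro nn_integral_cong) (auto simp: indicator_def)
  also have "\<dots> = 1"
    using layer_moment_log_gain[OF assms(1,2), of 0 x0 k] assms(3) G.prob_space by simp
  finally have "prob ?S = 1" by (simp add: emeasure_eq_measure)
  thus "AE \<omega> in M. layer a W x0 k \<omega> \<noteq> 0" using prob_eq_1[OF S] by simp
qed

text \<open>Once zeros are excluded, negative powers tending to 0 force the norms to infinity. The
  bound on \<open>p\<close> keeps the exponent in the range of known integrability.\<close>

lemma AE_layer_at_top:
  assumes "0 < a" "a \<le> 1" "x0 \<noteq> 0" "0 < p" "p \<le> 1/2"
    and "(\<integral>z. exp (- p * log_gain a \<sigma> (z :: real ^ 'd)) \<partial>std_gauss_vec) < 1"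
  shows "AE \<omega> in M. filterlim (\<lambda>k. norm (layer a W x0 k \<omega>)) at_top sequentially"
proof -
  have "AE \<omega> in M. (\<lambda>k. norm (layer a W x0 k \<omega>) powr (- p)) \<longlonglongrightarrow> 0"
    using assms by (intro AE_layer_powr_tendsto_0_log_gain) auto
  thus ?thesis using AE_layer_nonzero[OF assms(1-3)]
  proof eventually_elim
    case (elim \<omega>)
    let ?n = "\<lambda>k. norm (layer a W x0 k \<omega>)"
    have pos: "?n k > 0" for k using elim by simp
    show ?case unfolding filterlim_at_top_gt[where c=0]
    proof safe
      fix Z :: real assume Z: "Z > 0"
      have "eventually (\<lambda>k. ?n k powr (- p) < Z powr (- p)) sequentially"
        using elim(1) Z by (intro order_tendstoD(2)) auto
      thus "eventually (\<lambda>k. Z \<le> ?n k) sequentially"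
      proof eventually_elim
        case (elim k)
        show ?case
        proof (rule ccontr)
          assume "\<not> Z \<le> ?n k"
          hence "Z powr (- p) \<le> ?n k powr (- p)"
            using pos[of k] assms by (intro powr_mono2') auto
          thus False using elim by simp
        qed
      qed
    qed
  qed
qed

lemma layer_moment_tendsto_0:
  assumes "0 < a" "a \<le> 1" "0 < p"
    and "(\<integral>z. exp (p * log_gain a \<sigma> (z :: real ^ 'd)) \<partial>std_gauss_vec) < 1" (is "?g < 1")
  shows "(\<lambda>k. \<integral>\<^sup>+\<omega>. ennreal (norm (layer a W x0 k \<omega>) powr p) \<partial>M) \<longlonglongrightarrow> 0"
proof -
  have "(\<lambda>k. norm x0 powr p * ?g ^ k) \<longlonglongrightarrow> norm x0 powr p * 0"
    using assms by (intro tendsto_mult_left LIMSEQ_power_zero) simp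
  hence "(\<lambda>k. ennreal (norm x0 powr p * ?g ^ k)) \<longlonglongrightarrow> ennreal 0"
    by (intro tendsto_ennrealI) simp
  thus ?thesis using assms by (simp add: layer_moment_log_gain)
qed

lemma layer_moment_tendsto_top:
  assumes "0 < a" "a \<le> 1" "x0 \<noteq> 0" "0 < p"
    and "1 < (\<integral>z. exp (p * log_gain a \<sigma> (z :: real ^ 'd)) \<partial>std_gauss_vec)" (is "1 < ?g")
  shows "(\<lambda>k. \<integral>\<^sup>+\<omega>. ennreal (norm (layer a W x0 k \<omega>) powr p) \<partial>M) \<longlonglongrightarrow> \<infinity>"
proof -
  have "filterlim (\<lambda>k. norm x0 powr p * ?g ^ k) at_top sequentially"
    using assms by (intro filterlim_tendsto_pos_mult_at_top[OF tendsto_const]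
        filterlim_at_infinity_imp_filterlim_at_top filterlim_realpow_sequentially_gt1)
      (auto intro!: always_eventually)
  hence "(\<lambda>k. ennreal (norm x0 powr p * ?g ^ k)) \<longlonglongrightarrow> top"
    by (rule ennreal_tendsto_top_eq_at_top[THEN iffD2])
  thus ?thesis using assms by (simp add: layer_moment_log_gain)
qed

end

section \<open>Assembly of the three regimes\<close>

theorem mainTheorem9:
  fixes M :: "'w measure" and W :: "nat \<Rightarrow> 'w \<Rightarrow> real ^ 'd ^ 'd"
    and x0 :: "real ^ 'd" and \<sigma> a :: real
  assumes "prob_space M"
    and "\<sigma> > 0" and "0 \<le> a" and "a \<le> 1"
    and "x0 \<noteq> 0"
    and indep: "prob_space.indep_vars M (\<lambda>_. borel) (\<lambda>(k, i, j) \<omega>. W k \<omega> $ i $ j)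
                  ({1..} \<times> UNIV \<times> UNIV)"
    and gauss: "\<And>k i j. k \<ge> 1 \<Longrightarrow>
                  distributed M lborel (\<lambda>\<omega>. W k \<omega> $ i $ j) (\<lambda>t. ennreal (normal_density 0 \<sigma> t))"
  shows
    "(a = 0 \<longrightarrow> (AE \<omega> in M. (\<lambda>k. layer a W x0 k \<omega>) \<longlonglongrightarrow> 0))
     \<and> (0 < a \<longrightarrow>
          ((mu_a a \<sigma> TYPE('d) < 0 \<longleftrightarrow> (\<exists>s>0. \<sigma> = sigma_bar a s TYPE('d)))
           \<and> (\<forall>s>0. \<sigma> = sigma_bar a s TYPE('d) \<longrightarrow>
                (s \<ge> 1 \<longrightarrow> (AE \<omega> in M. (\<lambda>k. layer a W x0 k \<omega>) \<longlonglongrightarrow> 0))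
              \<and> (s < 1 \<longrightarrow>
                   (\<forall>p. 0 < p \<and> p < s \<longrightarrow>
                      (\<lambda>k. \<integral>\<^sup>+ \<omega>. ennreal (norm (layer a W x0 k \<omega>) powr p) \<partial>M) \<longlonglongrightarrow> 0)
                 \<and> (\<exists>r. strict_mono r \<and> (AE \<omega> in M. (\<lambda>k. layer a W x0 (r k) \<omega>) \<longlonglongrightarrow> 0))))))
     \<and> (0 < a \<and> mu_a a \<sigma> TYPE('d) > 0 \<longrightarrow>
          (\<forall>p>0. (\<lambda>k. \<integral>\<^sup>+ \<omega>. ennreal (norm (layer a W x0 k \<omega>) powr p) \<partial>M) \<longlonglongrightarrow> \<infinity>)
          \<and> (\<exists>r. strict_mono r \<and>
               (AE \<omega> in M. filterlim (\<lambda>k. norm (layer a W x0 (r k) \<omega>)) at_top sequentially)))"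
proof -
  interpret gaussian_layers M W \<sigma>
    by (intro gaussian_layers.intro gaussian_layers_axioms.intro) (use assms in auto)
  interpret G: prob_space "std_gauss_vec :: (real ^ 'd) measure" by (rule prob_space_std_gauss_vec)
  let ?L = "log_gain a \<sigma> :: real ^ 'd \<Rightarrow> real"
  let ?g = "\<lambda>p. G.expectation (\<lambda>z. exp (p * ?L z))"
  have L: "?L \<in> borel_measurable std_gauss_vec" by measurable
  have id: "strict_mono (\<lambda>k::nat. k)" by (simp add: strict_mono_def)
  note unb = log_gain_unbounded[OF \<open>\<sigma> > 0\<close>]
  show ?thesis
  proof (intro conjI impI)
    assume "a = 0"
    thus "AE \<omega> in M. (\<lambda>k. layer a W x0 k \<omega>) \<longlonglongrightarrow> 0"
      using AE_relu_layer_tendsto_0 by simp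
  next
    assume a: "0 < a"
    note int = integrable_exp_log_gain[OF a \<open>a \<le> 1\<close> \<open>\<sigma> > 0\<close>, where 'd='d]
    have root: "?g p < 1" if "0 < p" "p < s" "\<sigma> = sigma_bar a s TYPE('d)" for p s
      using that int[of s] eq_sigma_bar_iff[OF a \<open>a \<le> 1\<close> \<open>\<sigma> > 0\<close>, of s, where 'd='d] unb[of a 0]
      by (intro G.mgf_less_1_below_root[OF L]) auto
    show "mu_a a \<sigma> TYPE('d) < 0 \<longleftrightarrow> (\<exists>s>0. \<sigma> = sigma_bar a s TYPE('d))"
    proof
      assume "mu_a a \<sigma> TYPE('d) < 0"
      hence "G.expectation ?L < 0" using mu_a_eq_expectation[OF a \<open>a \<le> 1\<close> \<open>\<sigma> > 0\<close>, where 'd='d] by simp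
      then obtain s where "0 < s" "?g s = 1"
        using G.mgf_root_exists[OF L int int unb[of a 1]] by auto
      thus "\<exists>s>0. \<sigma> = sigma_bar a s TYPE('d)"
        using eq_sigma_bar_iff[OF a \<open>a \<le> 1\<close> \<open>\<sigma> > 0\<close>, of s, where 'd='d] by auto
    next
      assume "\<exists>s>0. \<sigma> = sigma_bar a s TYPE('d)"
      then obtain s where s: "s > 0" "\<sigma> = sigma_bar a s TYPE('d)" by blast
      \<comment> \<open>Any exponent strictly between 0 and \<open>s\<close> would do: there the
        tangent line at 0 lies below a value smaller than 1, so its slope is negative.\<close>
      have "1 + s/2 * G.expectation ?L \<le> ?g (s/2)"
        using s by (intro G.mgf_ge_linear integrable_log_gain a \<open>a \<le> 1\<close> \<open>\<sigma> > 0\<close> int) auto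
      also have "\<dots> < 1" using s by (intro root[of _ s]) auto
      finally have "G.expectation ?L < 0" using s by (simp add: mult_less_0_iff)
      thus "mu_a a \<sigma> TYPE('d) < 0" using mu_a_eq_expectation[OF a \<open>a \<le> 1\<close> \<open>\<sigma> > 0\<close>, where 'd='d] by simp
    qed
    show "\<forall>s>0. \<sigma> = sigma_bar a s TYPE('d) \<longrightarrow>
                (s \<ge> 1 \<longrightarrow> (AE \<omega> in M. (\<lambda>k. layer a W x0 k \<omega>) \<longlonglongrightarrow> 0))
              \<and> (s < 1 \<longrightarrow>
                   (\<forall>p. 0 < p \<and> p < s \<longrightarrow>
                      (\<lambda>k. \<integral>\<^sup>+ \<omega>. ennreal (norm (layer a W x0 k \<omega>) powr p) \<partial>M) \<longlonglongrightarrow> 0)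
                 \<and> (\<exists>r. strict_mono r \<and> (AE \<omega> in M. (\<lambda>k. layer a W x0 (r k) \<omega>) \<longlonglongrightarrow> 0)))"
    proof (intro allI impI)
      fix s assume s: "s > 0" "\<sigma> = sigma_bar a s TYPE('d)"
      \<comment> \<open>The contracting exponent \<open>s/2\<close> gives convergence of the full
        sequence for every \<open>s\<close>, which settles the almost sure claims on both sides of
        \<open>s = 1\<close>.\<close>
      have "AE \<omega> in M. (\<lambda>k. layer a W x0 k \<omega>) \<longlonglongrightarrow> 0"
        using s root[of "s/2" s] by (intro AE_layer_tendsto_0[OF a \<open>a \<le> 1\<close>, of "s/2"]) auto
      moreover have "(\<lambda>k. \<integral>\<^sup>+ \<omega>. ennreal (norm (layer a W x0 k \<omega>) powr p) \<partial>M) \<longlonglongrightarrow> 0"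
        if "0 < p" "p < s" for p
        using that s root[of p s] by (intro layer_moment_tendsto_0[OF a \<open>a \<le> 1\<close>]) auto
      ultimately show "(s \<ge> 1 \<longrightarrow> (AE \<omega> in M. (\<lambda>k. layer a W x0 k \<omega>) \<longlonglongrightarrow> 0))
              \<and> (s < 1 \<longrightarrow>
                   (\<forall>p. 0 < p \<and> p < s \<longrightarrow>
                      (\<lambda>k. \<integral>\<^sup>+ \<omega>. ennreal (norm (layer a W x0 k \<omega>) powr p) \<partial>M) \<longlonglongrightarrow> 0)
                 \<and> (\<exists>r. strict_mono r \<and> (AE \<omega> in M. (\<lambda>k. layer a W x0 (r k) \<omega>) \<longlonglongrightarrow> 0)))"
        using id by blast
    qed
  next
    assume "0 < a \<and> mu_a a \<sigma> TYPE('d) > 0"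
    hence a: "0 < a" and "mu_a a \<sigma> TYPE('d) > 0" by auto
    hence pos: "G.expectation ?L > 0" using mu_a_eq_expectation[OF a \<open>a \<le> 1\<close> \<open>\<sigma> > 0\<close>, where 'd='d] by simp
    note int = integrable_exp_log_gain[OF a \<open>a \<le> 1\<close> \<open>\<sigma> > 0\<close>, where 'd='d]
    show "\<forall>p>0. (\<lambda>k. \<integral>\<^sup>+ \<omega>. ennreal (norm (layer a W x0 k \<omega>) powr p) \<partial>M) \<longlonglongrightarrow> \<infinity>"
    proof (intro allI impI)
      fix p :: real assume p: "p > 0"
      have "1 < 1 + p * G.expectation ?L" using p pos by simp
      also have "\<dots> \<le> ?g p"
        using p by (intro G.mgf_ge_linear integrable_log_gain a \<open>a \<le> 1\<close> \<open>\<sigma> > 0\<close> int) auto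
      finally show "(\<lambda>k. \<integral>\<^sup>+ \<omega>. ennreal (norm (layer a W x0 k \<omega>) powr p) \<partial>M) \<longlonglongrightarrow> \<infinity>"
        by (rule layer_moment_tendsto_top[OF a \<open>a \<le> 1\<close> \<open>x0 \<noteq> 0\<close> p])
    qed
    \<comment> \<open>In the direction -1 the slope is negative, so a small negative exponent
      contracts; \<open>- p\<close> stays above -1/2.\<close>
    obtain p where "0 < p" "p \<le> 1/4" "?g (- 1 * p) < 1"
      using G.mgf_less_1[OF L int int, of "-1"] pos by auto
    hence "AE \<omega> in M. filterlim (\<lambda>k. norm (layer a W x0 k \<omega>)) at_top sequentially"
      by (intro AE_layer_at_top[OF a \<open>a \<le> 1\<close> \<open>x0 \<noteq> 0\<close>, of p]) auto
    thus "\<exists>r. strict_mono r \<and>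
               (AE \<omega> in M. filterlim (\<lambda>k. norm (layer a W x0 (r k) \<omega>)) at_top sequentially)"
      using id by blast
  qed
qed

end
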